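(* Let $B:[0,T]\to\mathrm{Sym}(2n)$ be continuous, $\psi$ the fundamental solution of $z'=J_0B(t)z$ with $\psi(0)=\mathrm{Id}$, $L,L_1,L_2\in\Lambda(n)$ and $\ell(t)=\psi(t)L$. Assume that $\ell$ is an $L_1$-plus curve and an $L_2$-plus curve. For $i=1,2$ let $\nu(L_i,[0,T])=\sum_{t\in[0,T]}\dim(\ell(t)\cap L_i)$ (finite sum). Let $$e_i=\dim(L\cap\ell(T))-\dim(L\cap\ell(T)\cap L_i)\ (i=1,2),\quad \delta_1=L\cap L_1+L_1\cap L_2,\quad \delta_2=\ell(T)\cap L_2+L_1\cap L_2,$$ $k_1=\min\{e_1,e_2\}$, $k_2=\min\{\dim\delta_1,\dim\delta_2\}$, $k=\max\{k_1,k_2\}$. Then $$\big|\nu(L_2,[0,T])-\nu(L_1,[0,T])\big|\le n-k.$$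
   Context: The standard symplectic space is $\mathbb R^{2n}=\mathbb R^n\oplus\mathbb R^n$ with coordinates $z=(p,q)$, $\omega_0((p_1,q_1),(p_2,q_2))=\langle p_1,q_2\rangle-\langle q_1,p_2\rangle$, $J_0(p,q)=(-q,p)$; $\Lambda(n)$ is its Lagrangian Grassmannian and $\mathrm{Sym}(2n)$ the symmetric $2n\times2n$ matrices. For $L_0\in\Lambda(n)$ and a $\mathscr C^1$ path $\ell$ in $\Lambda(n)$, a crossing is an instant $t_0$ with $\ell(t_0)\cap L_0\ne\{0\}$; the crossing form on $\ell(t_0)\cap L_0$ is $\Gamma(\ell,L_0,t_0)[v]=\frac{d}{dt}|_{t=t_0}\omega_0(v,w(t))$, where $W$ is a fixed Lagrangian transversal to $\ell(t_0)$ and $w(t)\in W$ is the unique vector with $v+w(t)\in\ell(t)$. The curve $\ell$ is an $L_0$-plus curve if at every crossing instant the crossing form is positive definite. *)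

theory Defs
  imports "HOL-Analysis.Analysis"
begin

definition omega0 :: "((real^'n) \<times> (real^'n)) \<Rightarrow> ((real^'n) \<times> (real^'n)) \<Rightarrow> real" where
  "omega0 z1 z2 = fst z1 \<bullet> snd z2 - snd z1 \<bullet> fst z2"

definition J0 :: "((real^'n) \<times> (real^'n)) \<Rightarrow> ((real^'n) \<times> (real^'n))" where
  "J0 z = (- snd z, fst z)"

definition lagrangian :: "((real^'n) \<times> (real^'n)) set \<Rightarrow> bool" where
  "lagrangian L \<longleftrightarrow> subspace L \<and> dim L = CARD('n) \<and> (\<forall>v\<in>L. \<forall>w\<in>L. omega0 v w = 0)"

definition symmetric_op :: "(((real^'n) \<times> (real^'n)) \<Rightarrow>\<^sub>L ((real^'n) \<times> (real^'n))) \<Rightarrow> bool" where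
  "symmetric_op A \<longleftrightarrow> (\<forall>x y. blinfun_apply A x \<bullet> y = x \<bullet> blinfun_apply A y)"

text \<open>Crossing form at t0: for v in l(t0) \<inter> L0 and W a Lagrangian transversal to l(t0),
  w(t) is the unique vector of W with v + w(t) \<in> l(t); the crossing form is the
  derivative of omega0 v (w t) at t0 (one-sided at the endpoints of [0,T]).
  A curve is an L0-plus curve on [0,T] if at every crossing instant the crossing form is
  positive definite (for any admissible choice of W).\<close>
definition plus_curve ::
  "real \<Rightarrow> (real \<Rightarrow> ((real^'n) \<times> (real^'n)) set) \<Rightarrow> ((real^'n) \<times> (real^'n)) set \<Rightarrow> bool" where
  "plus_curve T l L0 \<longleftrightarrow>
     (\<forall>t0\<in>{0..T}. l t0 \<inter> L0 \<noteq> {0} \<longrightarrow>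
        (\<forall>W. lagrangian W \<and> W \<inter> l t0 = {0} \<longrightarrow>
           (\<forall>v\<in>l t0 \<inter> L0. v \<noteq> 0 \<longrightarrow>
              (\<exists>D>0. ((\<lambda>t. omega0 v (THE w. w \<in> W \<and> v + w \<in> l t)) has_real_derivative D)
                        (at t0 within {0..T})))))"

definition nu_index ::
  "real \<Rightarrow> (real \<Rightarrow> ((real^'n) \<times> (real^'n)) set) \<Rightarrow> ((real^'n) \<times> (real^'n)) set \<Rightarrow> nat" where
  "nu_index T l L0 = (\<Sum>t\<in>{t\<in>{0..T}. l t \<inter> L0 \<noteq> {0}}. dim (l t \<inter> L0))"

definition set_plus :: "'a::plus set \<Rightarrow> 'a set \<Rightarrow> 'a set" where
  "set_plus A B = {x + y | x y. x \<in> A \<and> y \<in> B}"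

end

theory Submission
  imports Defs
begin

text \<open>
  For Lagrangians \<open>A, B, C\<close> let \<open>q\<close> be Kashiwara's quadratic form on \<open>A \<times> B \<times> C\<close>; its radical is
  isomorphic to \<open>(A \<inter> B) \<times> (A \<inter> C) \<times> (B \<inter> C)\<close>. For \<open>A = \<ell>(t)\<close>, \<open>B = L\<^sub>1\<close>, \<open>C = L\<^sub>2\<close>, pull \<open>q\<close> back by
  \<open>\<psi>(t)\<close> to the fixed space \<open>L \<times> L\<^sub>1 \<times> L\<^sub>2\<close>. The part \<open>L\<^sub>1 \<inter> L\<^sub>2\<close> of the radical is constant, and at a
  crossing the derivative of the form on the rest of the radical is the crossing form of \<open>L\<^sub>1\<close> minus
  that of \<open>L\<^sub>2\<close> (up to a factor). Hence crossings are isolated, and the positive index \<open>m(t)\<close> jumps up by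
  \<open>dim (\<ell>(t) \<inter> L\<^sub>1)\<close> to the right of \<open>t\<close> and is larger by \<open>dim (\<ell>(t) \<inter> L\<^sub>2)\<close> to the left. Summing the jumps,
  \<open>\<nu>(L\<^sub>1) - \<nu>(L\<^sub>2) = (m(T) + dim (\<ell>(T) \<inter> L\<^sub>1)) - (m(0) + dim (L \<inter> L\<^sub>2))\<close>.
  The bound by \<open>k\<^sub>2\<close> comes from the isotropic subspace \<open>0 \<times> L\<^sub>1 \<times> 0\<close>, which forces both inertia indices to
  be large; the bound by \<open>k\<^sub>1\<close> comes from comparing the forms for \<open>\<ell>(0)\<close> and \<open>\<ell>(T)\<close> on the common subspace
  \<open>(L \<inter> \<ell>(T)) \<times> L\<^sub>1 \<times> L\<^sub>2\<close>.
\<close>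

section \<open>Inertia of symmetric bilinear forms\<close>

definition posdef_on :: "('a::real_vector \<Rightarrow> 'a \<Rightarrow> real) \<Rightarrow> 'a set \<Rightarrow> bool" where
  "posdef_on b S \<longleftrightarrow> (\<forall>x\<in>S. x \<noteq> 0 \<longrightarrow> b x x > 0)"

text \<open>Sylvester's basis-free positive inertia index. The negative index of \<open>b\<close> is
  taken to be the positive index of \<open>\<lambda>x y. - b x y\<close>.\<close>

definition pos_index :: "'a::euclidean_space set \<Rightarrow> ('a \<Rightarrow> 'a \<Rightarrow> real) \<Rightarrow> nat" where
  "pos_index E b = Max {dim S | S. subspace S \<and> S \<subseteq> E \<and> posdef_on b S}"

definition form_radical :: "'a set \<Rightarrow> ('a \<Rightarrow> 'a \<Rightarrow> real) \<Rightarrow> 'a set" where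
  "form_radical E b = {x\<in>E. \<forall>y\<in>E. b x y = 0}"

definition sym_bilinear :: "('a::real_vector \<Rightarrow> 'a \<Rightarrow> real) \<Rightarrow> bool" where
  "sym_bilinear b \<longleftrightarrow> bilinear b \<and> (\<forall>x y. b x y = b y x)"

lemma sym_bilinear_uminus: "sym_bilinear b \<Longrightarrow> sym_bilinear (\<lambda>x y. - b x y)"
  by (auto simp: sym_bilinear_def bilinear_def intro!: linear_compose_neg)

lemma sym_bilinear_simps:
  assumes "sym_bilinear b"
  shows "b (x + y) z = b x z + b y z" "b x (y + z) = b x y + b x z"
    "b (x - y) z = b x z - b y z" "b x (y - z) = b x y - b x z"
    "b (c *\<^sub>R x) y = c * b x y" "b x (c *\<^sub>R y) = c * b x y" "b 0 x = 0" "b x 0 = 0"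
    "b (- x) y = - b x y" "b x (- y) = - b x y"
proof -
  have b: "bilinear b" using assms by (simp add: sym_bilinear_def)
  show "b (x + y) z = b x z + b y z" "b x (y + z) = b x y + b x z"
    "b (x - y) z = b x z - b y z" "b x (y - z) = b x y - b x z"
    "b (c *\<^sub>R x) y = c * b x y" "b x (c *\<^sub>R y) = c * b x y" "b 0 x = 0" "b x 0 = 0"
    "b (- x) y = - b x y" "b x (- y) = - b x y"
    using bilinear_ladd[OF b] bilinear_radd[OF b] bilinear_lsub[OF b] bilinear_rsub[OF b]
      bilinear_lmul[OF b] bilinear_rmul[OF b] bilinear_lzero[OF b] bilinear_rzero[OF b]
      bilinear_lneg[OF b] bilinear_rneg[OF b]
    by simp_all
qed

lemma sym_bilinear_diff:
  assumes "sym_bilinear f" "sym_bilinear g"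
  shows "sym_bilinear (\<lambda>x y. f x y - g x y)"
  using assms by (auto simp: sym_bilinear_def bilinear_def intro!: linear_compose_sub)

lemma sym_bilinear_divide:
  assumes f: "sym_bilinear f"
  shows "sym_bilinear (\<lambda>x y. f x y / c)"
  using f unfolding sym_bilinear_def bilinear_def
  by (auto intro!: linearI simp: sym_bilinear_simps[OF f] add_divide_distrib)

lemma sym_bilinear_commute: "sym_bilinear b \<Longrightarrow> b x y = b y x"
  by (simp add: sym_bilinear_def)

lemma subspace_form_radical:
  assumes "sym_bilinear b" "subspace E"
  shows "subspace (form_radical E b)"
  using assms(2) by (auto simp: subspace_def form_radical_def sym_bilinear_simps[OF assms(1)])

lemma form_radical_uminus: "form_radical E (\<lambda>x y. - b x y) = form_radical E b"
  by (simp add: form_radical_def)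

lemma pos_index_finite: "finite {dim S | S. subspace S \<and> S \<subseteq> (E::'a::euclidean_space set) \<and> posdef_on b S}"
proof (rule finite_subset)
  show "{dim S | S. subspace S \<and> S \<subseteq> E \<and> posdef_on b S} \<subseteq> {..DIM('a)}"
    by (auto intro: dim_subset_UNIV)
qed auto

lemma pos_index_ge:
  assumes "subspace S" "S \<subseteq> E" "posdef_on b S"
  shows "dim S \<le> pos_index E b"
  unfolding pos_index_def using assms by (intro Max_ge pos_index_finite) auto

lemma pos_index_witness:
  assumes "subspace E"
  obtains S where "subspace S" "S \<subseteq> E" "posdef_on b S" "dim S = pos_index E b"
proof -
  have "dim {0::'a} \<in> {dim S | S. subspace S \<and> S \<subseteq> E \<and> posdef_on b S}"
    using assms by (auto intro!: exI[of _ "{0}"] simp: posdef_on_def subspace_0)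
  then have "pos_index E b \<in> {dim S | S. subspace S \<and> S \<subseteq> E \<and> posdef_on b S}"
    unfolding pos_index_def by (intro Max_in pos_index_finite) auto
  then show thesis using that by auto
qed

section \<open>Dimension counts for sums and intersections of subspaces\<close>

lemma dim_set_plus_Int:
  fixes A B :: "'a::euclidean_space set"
  assumes "subspace A" "subspace B"
  shows "dim (set_plus A B) + dim (A \<inter> B) = dim A + dim B"
  using dim_sums_Int[OF assms] by (simp add: set_plus_def)

lemma subspace_set_plus:
  "subspace A \<Longrightarrow> subspace B \<Longrightarrow> subspace (set_plus A B)"
  unfolding set_plus_def by (rule subspace_sums)

lemma set_plus_subset:
  "subspace E \<Longrightarrow> A \<subseteq> E \<Longrightarrow> B \<subseteq> E \<Longrightarrow> set_plus A B \<subseteq> E"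
  by (auto simp: set_plus_def intro: subspace_add)

lemma dim_Int_ge:
  fixes A B E :: "'a::euclidean_space set"
  assumes "subspace A" "subspace B" "subspace E" "A \<subseteq> E" "B \<subseteq> E"
  shows "dim A + dim B \<le> dim E + dim (A \<inter> B)"
  using dim_set_plus_Int[OF assms(1,2)] dim_subset[OF set_plus_subset[OF assms(3-5)]] by simp

lemma dim_set_plus_disjoint:
  fixes A B :: "'a::euclidean_space set"
  assumes "subspace A" "subspace B" "A \<inter> B \<subseteq> {0}"
  shows "dim (set_plus A B) = dim A + dim B"
proof -
  have "dim (A \<inter> B) = 0" using assms(3) by simp
  then show ?thesis using dim_set_plus_Int[OF assms(1,2)] by linarith
qed

lemma subspace_complement:
  fixes U M :: "'a::euclidean_space set"
  assumes "subspace U" "subspace M" "U \<subseteq> M"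
  obtains C where "subspace C" "C \<subseteq> M" "C \<inter> U = {0}" "dim C + dim U = dim M"
proof -
  let ?C = "{y \<in> M. \<forall>x \<in> U. orthogonal x y}"
  have "subspace ?C"
    using assms(2) by (auto simp: subspace_def orthogonal_def inner_add_right)
  moreover have "?C \<inter> U = {0}"
    using assms by (auto simp: orthogonal_def subspace_0)
  ultimately show thesis
    using dim_subspace_orthogonal_to_vectors[OF assms] that[of ?C] by auto
qed

text \<open>Each condition \<open>b p x = 0\<close> is orthogonality to the Riesz vector
  \<open>A p\<close>, so the conditions from \<open>P\<close> cut out a subspace whose codimension
  is at most the dimension of the image of \<open>P\<close> under \<open>A\<close>.\<close>

lemma dim_form_orthogonal_ge:
  fixes b :: "'a::euclidean_space \<Rightarrow> 'a \<Rightarrow> real"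
  assumes b: "sym_bilinear b" and E: "subspace E" and P: "subspace P"
  shows "dim E \<le> dim {x\<in>E. \<forall>p\<in>P. b p x = 0} + dim P"
proof -
  define A where "A p = (\<Sum>i\<in>Basis. b p i *\<^sub>R i)" for p
  have linA: "linear A"
    by (rule linearI)
      (simp_all add: A_def sym_bilinear_simps[OF b] scaleR_left_distrib sum.distrib scaleR_sum_right)
  have A: "A p \<bullet> x = b p x" for p x
  proof -
    have "linear (b p)" using b by (simp add: sym_bilinear_def bilinear_def)
    then have "b p (\<Sum>i\<in>Basis. (x \<bullet> i) *\<^sub>R i) = (\<Sum>i\<in>Basis. (x \<bullet> i) * b p i)"
      by (simp add: linear_sum linear_scale)
    then have "b p x = (\<Sum>i\<in>Basis. (x \<bullet> i) * b p i)"
      by (simp add: euclidean_representation)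
    then show ?thesis
      by (simp add: A_def inner_sum_left inner_commute[of x] mult.commute)
  qed
  define Q where "Q = {x. \<forall>y\<in>A ` P. orthogonal y x}"
  have Q: "subspace Q"
    by (auto simp: Q_def subspace_def orthogonal_def inner_add_right)
  have "dim {y \<in> UNIV. \<forall>x\<in>A ` P. orthogonal x y} + dim (A ` P) = dim (UNIV::'a set)"
    by (rule dim_subspace_orthogonal_to_vectors) (use linA P linear_subspace_image in auto)
  then have "dim Q + dim (A ` P) = DIM('a)" by (simp add: Q_def dim_UNIV)
  moreover have "dim (A ` P) \<le> dim P" by (rule dim_image_le[OF linA])
  moreover have "dim E + dim Q \<le> dim (UNIV :: 'a set) + dim (E \<inter> Q)"
    by (rule dim_Int_ge) (use E Q in auto)
  moreover have "E \<inter> Q = {x\<in>E. \<forall>p\<in>P. b p x = 0}"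
    by (auto simp: Q_def orthogonal_def A)
  ultimately show ?thesis by (simp add: dim_UNIV)
qed

text \<open>Since \<open>b x x = 0\<close>, the value of the form at
  \<open>c *\<^sub>R x + y\<close> is affine in \<open>c\<close>. Bounded above for all real
  \<open>c\<close>, it must have slope zero.\<close>

lemma semidefinite_null:
  assumes b: "sym_bilinear b" and M: "subspace M" and le: "\<And>x. x \<in> M \<Longrightarrow> b x x \<le> 0"
    and x: "x \<in> M" "b x x = 0" and y: "y \<in> M"
  shows "b x y = 0"
proof (rule ccontr)
  assume nz: "b x y \<noteq> 0"
  have q: "2 * c * b x y + b y y \<le> 0" for c
  proof -
    have "c *\<^sub>R x + y \<in> M" using M x y by (simp add: subspace_add subspace_scale)
    from le[OF this] show ?thesis
      using x sym_bilinear_commute[OF b, of y x] by (simp add: sym_bilinear_simps[OF b])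
  qed
  \<comment> \<open>With this \<open>c\<close> the left side of \<open>q\<close> equals 1.\<close>
  show False using q[of "(1 - b y y) / (2 * b x y)"] nz by (simp add: field_simps)
qed

lemma posdef_Int_radical:
  assumes "P \<subseteq> E" "posdef_on b P" "N \<subseteq> form_radical E b"
  shows "P \<inter> N \<subseteq> {0}"
proof
  fix x assume x: "x \<in> P \<inter> N"
  then have "b x x = 0" using assms by (force simp: form_radical_def)
  then show "x \<in> {0}" using x assms(2) by (force simp: posdef_on_def)
qed

text \<open>Radical vectors pair to zero with all of \<open>E\<close>, so the value at
  \<open>p + r\<close> is just \<open>b p p\<close>.\<close>

lemma posdef_plus_radical:
  assumes b: "sym_bilinear b" and P: "P \<subseteq> E" "posdef_on b P" and N: "N \<subseteq> form_radical E b"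
    and x: "x \<in> set_plus P N"
  shows "0 \<le> b x x" and "b x x = 0 \<Longrightarrow> x \<in> N"
proof -
  obtain p r where x: "x = p + r" "p \<in> P" "r \<in> N" using x by (auto simp: set_plus_def)
  have p: "p \<in> E" and r: "r \<in> E" "\<And>y. y \<in> E \<Longrightarrow> b r y = 0"
    using x P(1) N by (auto simp: form_radical_def)
  have "b x x = b p p"
    using x r(2)[OF p] r(2)[OF r(1)] sym_bilinear_commute[OF b, of p r]
    by (simp add: sym_bilinear_simps[OF b])
  then have "p = 0 \<and> b x x = 0 \<or> b x x > 0"
    using P(2) x(2) by (cases "p = 0") (auto simp: posdef_on_def sym_bilinear_simps[OF b])
  then show "0 \<le> b x x" "b x x = 0 \<Longrightarrow> x \<in> N" using x by auto
qed

text \<open>The form is nonnegative on a maximal positive subspace plus the radical and negative on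
  a maximal negative subspace, so the three sum directly inside \<open>E\<close>.\<close>

lemma pos_index_sum_le:
  assumes b: "sym_bilinear b" and E: "subspace E"
  shows "pos_index E b + pos_index E (\<lambda>x y. - b x y) + dim (form_radical E b) \<le> dim E"
proof -
  let ?R = "form_radical E b"
  obtain P where P: "subspace P" "P \<subseteq> E" "posdef_on b P" "dim P = pos_index E b"
    using pos_index_witness[OF E] .
  obtain N where N: "subspace N" "N \<subseteq> E" "posdef_on (\<lambda>x y. - b x y) N"
    "dim N = pos_index E (\<lambda>x y. - b x y)"
    using pos_index_witness[OF E] .
  have R: "subspace ?R" "?R \<subseteq> E" using subspace_form_radical[OF b E] by (auto simp: form_radical_def)
  have PR: "P \<inter> ?R \<subseteq> {0}" using P by (intro posdef_Int_radical) auto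
  have "set_plus P ?R \<inter> N \<subseteq> {0}"
  proof
    fix x assume x: "x \<in> set_plus P ?R \<inter> N"
    then have "b x x \<ge> 0" using posdef_plus_radical(1)[OF b P(2,3) order_refl] by auto
    then show "x \<in> {0}" using x N(3) by (force simp: posdef_on_def)
  qed
  then have "dim (set_plus (set_plus P ?R) N) = dim P + dim ?R + dim N"
    using dim_set_plus_disjoint P R N PR subspace_set_plus by metis
  moreover have "set_plus (set_plus P ?R) N \<subseteq> E"
    using P R N E by (intro set_plus_subset) auto
  ultimately show ?thesis using dim_subset P N by (metis add.assoc add.commute)
qed

text \<open>The missing inequality comes from maximality: on the \<open>b\<close>-orthogonal
  \<open>M\<close> of a maximal positive definite \<open>P\<close> the form is nonpositive and its
  null vectors lie in the radical, so a complement of \<open>M \<inter> ?R\<close> in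
  \<open>M\<close> is negative definite.\<close>

lemma sylvester_inertia:
  assumes b: "sym_bilinear b" and E: "subspace E"
  shows "pos_index E b + pos_index E (\<lambda>x y. - b x y) + dim (form_radical E b) = dim E"
proof -
  let ?R = "form_radical E b"
  have R: "subspace ?R" "?R \<subseteq> E" using subspace_form_radical[OF b E] by (auto simp: form_radical_def)
  obtain P where P: "subspace P" "P \<subseteq> E" "posdef_on b P" "dim P = pos_index E b"
    using pos_index_witness[OF E] .
  define M where "M = {x\<in>E. \<forall>p\<in>P. b p x = 0}"
  have M: "subspace M" "M \<subseteq> E" using E
    by (auto simp: M_def subspace_def sym_bilinear_simps[OF b])
  have PM: "P \<inter> M \<subseteq> {0}" using P(3) by (force simp: M_def posdef_on_def)
  have dimM: "dim E \<le> dim M + dim P"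
    unfolding M_def by (rule dim_form_orthogonal_ge[OF b E P(1)])
  \<comment> \<open>Otherwise \<open>x\<close> could be adjoined to \<open>P\<close>, whose
    dimension is already maximal.\<close>
  have le: "b x x \<le> 0" if x: "x \<in> M" for x
  proof (rule ccontr)
    assume "\<not> b x x \<le> 0"
    then have pos: "b x x > 0" by simp
    have x0: "x \<noteq> 0" using pos by (auto simp: sym_bilinear_simps[OF b])
    have S: "P \<inter> span {x} \<subseteq> {0}"
      using PM x M(1) span_minimal[of "{x}" M] by auto
    have "posdef_on b (set_plus P (span {x}))"
      unfolding posdef_on_def
    proof (intro ballI impI)
      fix v assume "v \<in> set_plus P (span {x})" "v \<noteq> 0"
      then obtain p c where v: "v = p + c *\<^sub>R x" "p \<in> P" "v \<noteq> 0"
        by (auto simp: set_plus_def span_singleton)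
      have px: "b p x = 0" "b x p = 0"
        using x v(2) sym_bilinear_commute[OF b, of x p] by (auto simp: M_def)
      have e: "b v v = b p p + c * c * b x x"
        using px by (simp add: v sym_bilinear_simps[OF b])
      show "b v v > 0"
      proof (cases "p = 0")
        case True
        then have "c \<noteq> 0" using v by auto
        then show ?thesis using e pos True by (simp add: sym_bilinear_simps[OF b] zero_less_mult_iff linorder_neq_iff disj_commute)
      next
        case False
        then have "b p p > 0" using P(3) v by (auto simp: posdef_on_def)
        then show ?thesis using e pos by (simp add: add_pos_nonneg)
      qed
    qed
    then have "dim (set_plus P (span {x})) \<le> pos_index E b"
      using P x M E by (intro pos_index_ge subspace_set_plus set_plus_subset span_minimal) auto
    moreover have "dim (set_plus P (span {x})) = dim P + 1"
      using dim_set_plus_disjoint[OF P(1) subspace_span S] x0 by (simp add: dim_singleton)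
    ultimately show False using P(4) by simp
  qed
  have PME: "set_plus P M = E"
  proof (rule subspace_dim_equal)
    show "dim E \<le> dim (set_plus P M)"
      using dim_set_plus_disjoint[OF P(1) M(1) PM] dimM by simp
  qed (use P M E in \<open>auto intro: subspace_set_plus set_plus_subset[THEN subsetD]\<close>)
  \<comment> \<open>Such an \<open>x\<close> is orthogonal to \<open>M\<close> by semidefiniteness
    and to \<open>P\<close> by the definition of \<open>M\<close>, and \<open>P\<close> and
    \<open>M\<close> together span \<open>E\<close>.\<close>
  have null: "x \<in> ?R" if x: "x \<in> M" "b x x = 0" for x
    unfolding form_radical_def
  proof (intro CollectI conjI ballI)
    show "x \<in> E" using x M by auto
    fix y assume "y \<in> E"
    then obtain p m where y: "y = p + m" "p \<in> P" "m \<in> M" using PME by (auto simp: set_plus_def)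
    have "b x m = 0" by (rule semidefinite_null[OF b M(1) le x(1,2) y(3)])
    moreover have "b x p = 0" using x y sym_bilinear_commute[OF b, of x p] by (auto simp: M_def)
    ultimately show "b x y = 0" by (simp add: y sym_bilinear_simps[OF b])
  qed
  obtain C where C: "subspace C" "C \<subseteq> M" "C \<inter> (M \<inter> ?R) = {0}" "dim C + dim (M \<inter> ?R) = dim M"
    using subspace_complement[of "M \<inter> ?R" M] M R subspace_inter by blast
  have "posdef_on (\<lambda>x y. - b x y) C"
    unfolding posdef_on_def
  proof (intro ballI impI)
    fix x assume x: "x \<in> C" "x \<noteq> 0"
    then have "b x x \<noteq> 0" using null C(2,3) by blast
    then show "- b x x > 0" using le[of x] x C(2) by fastforce
  qed
  then have "dim C \<le> pos_index E (\<lambda>x y. - b x y)"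
    using C M by (intro pos_index_ge) auto
  moreover have "dim (M \<inter> ?R) \<le> dim ?R" by (rule dim_subset) auto
  ultimately have "dim E \<le> pos_index E b + pos_index E (\<lambda>x y. - b x y) + dim ?R"
    using dimM P(4) C(4) by linarith
  then show ?thesis using pos_index_sum_le[OF b E] by linarith
qed

text \<open>A maximal negative definite subspace plus the radical has codimension
  \<open>pos_index E b\<close>, and \<open>S\<close> can meet it only inside the radical.\<close>

lemma dim_nonneg_subspace_le:
  assumes b: "sym_bilinear b" and E: "subspace E" and S: "subspace S" "S \<subseteq> E"
    and ge: "\<And>x. x \<in> S \<Longrightarrow> b x x \<ge> 0"
  shows "dim S \<le> pos_index E b + dim (S \<inter> form_radical E b)"
proof -
  let ?R = "form_radical E b"
  have R: "subspace ?R" "?R \<subseteq> E" using subspace_form_radical[OF b E] by (auto simp: form_radical_def)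
  obtain N where N: "subspace N" "N \<subseteq> E" "posdef_on (\<lambda>x y. - b x y) N"
    "dim N = pos_index E (\<lambda>x y. - b x y)"
    using pos_index_witness[OF E] .
  have NR: "N \<inter> ?R \<subseteq> {0}"
    using N by (intro posdef_Int_radical) (auto simp: form_radical_uminus)
  have "S \<inter> set_plus N ?R \<subseteq> S \<inter> ?R"
  proof
    fix x assume x: "x \<in> S \<inter> set_plus N ?R"
    have "?R \<subseteq> form_radical E (\<lambda>x y. - b x y)" by (simp add: form_radical_uminus)
    from posdef_plus_radical[OF sym_bilinear_uminus[OF b] N(2,3) this, of x] x ge[of x]
    show "x \<in> S \<inter> ?R" by auto
  qed
  then have "dim (S \<inter> set_plus N ?R) \<le> dim (S \<inter> ?R)" by (rule dim_subset)
  moreover have "dim S + dim (set_plus N ?R) \<le> dim E + dim (S \<inter> set_plus N ?R)"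
    using S N R E by (intro dim_Int_ge subspace_set_plus set_plus_subset) auto
  moreover have "dim (set_plus N ?R) = dim N + dim ?R"
    by (rule dim_set_plus_disjoint[OF N(1) R(1) NR])
  ultimately show ?thesis using sylvester_inertia[OF b E] N(4) by linarith
qed

section \<open>Transport of inertia along injective linear maps\<close>

lemma posdef_subset_image:
  assumes f: "linear f" "inj f" and S: "subspace S" "S \<subseteq> f ` E" "posdef_on b S"
  shows "\<exists>S'. subspace S' \<and> S' \<subseteq> E \<and> posdef_on (\<lambda>x y. b (f x) (f y)) S' \<and> f ` S' = S"
proof (intro exI[of _ "f -` S"] conjI)
  show "subspace (f -` S)" using f S by (intro linear_subspace_vimage)
  show "f -` S \<subseteq> E" using S(2) f(2) by (auto dest: injD)
  show "posdef_on (\<lambda>x y. b (f x) (f y)) (f -` S)"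
    using S(3) f linear_injective_0[OF f(1)] by (auto simp: posdef_on_def)
  show "f ` (f -` S) = S" using S(2) by auto
qed

text \<open>Lets inertia on a moving subspace be read as inertia of a moving form on a fixed
  one.\<close>

lemma pos_index_image:
  assumes f: "linear f" "inj f"
  shows "pos_index (f ` E) b = pos_index E (\<lambda>x y. b (f x) (f y))"
proof -
  have "{dim S | S. subspace S \<and> S \<subseteq> f ` E \<and> posdef_on b S} =
    {dim S | S. subspace S \<and> S \<subseteq> E \<and> posdef_on (\<lambda>x y. b (f x) (f y)) S}" (is "?A = ?B")
  proof
    show "?A \<subseteq> ?B"
    proof
      fix d assume "d \<in> ?A"
      then obtain S where S: "d = dim S" "subspace S" "S \<subseteq> f ` E" "posdef_on b S" by auto
      obtain S' where "subspace S'" "S' \<subseteq> E" "posdef_on (\<lambda>x y. b (f x) (f y)) S'" "f ` S' = S"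
        using posdef_subset_image[OF f S(2-4)] by blast
      moreover have "dim (f ` S') = dim S'"
        using f by (intro dim_image_eq) (auto intro: inj_on_subset)
      ultimately show "d \<in> ?B" using S(1) by auto
    qed
    show "?B \<subseteq> ?A"
    proof
      fix d assume "d \<in> ?B"
      then obtain S where S: "d = dim S" "subspace S" "S \<subseteq> E"
        "posdef_on (\<lambda>x y. b (f x) (f y)) S" by auto
      have "dim (f ` S) = dim S"
        using f by (intro dim_image_eq) (auto intro: inj_on_subset)
      moreover have "posdef_on b (f ` S)"
        using S(4) linear_0[OF f(1)] by (auto simp: posdef_on_def)
      moreover have "subspace (f ` S)" using f S(2) by (rule_tac linear_subspace_image)
      ultimately show "d \<in> ?A" using S by (intro CollectI exI[of _ "f ` S"]) auto
    qed
  qed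
  then show ?thesis by (simp add: pos_index_def)
qed

lemma form_radical_image:
  "form_radical (f ` E) b = f ` form_radical E (\<lambda>x y. b (f x) (f y))"
  by (auto simp: form_radical_def)

section \<open>First-order perturbation of the inertia\<close>

text \<open>Expanding in the basis bounds the quadratic form by its matrix entries; this turns
  entrywise convergence into uniform convergence on the unit sphere.\<close>

lemma sym_bilinear_bound:
  fixes f :: "'a::euclidean_space \<Rightarrow> 'a \<Rightarrow> real"
  assumes f: "sym_bilinear f" and le: "\<And>i j. i \<in> Basis \<Longrightarrow> j \<in> Basis \<Longrightarrow> \<bar>f i j\<bar> \<le> e"
    and x: "norm x = 1"
  shows "\<bar>f x x\<bar> \<le> real (DIM('a)) * (real (DIM('a)) * e)"
proof -
  have "f x x = f (\<Sum>i\<in>Basis. (x \<bullet> i) *\<^sub>R i) (\<Sum>j\<in>Basis. (x \<bullet> j) *\<^sub>R j)"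
    by (simp add: euclidean_representation)
  also have "\<dots> = (\<Sum>(i, j)\<in>Basis \<times> Basis. f ((x \<bullet> i) *\<^sub>R i) ((x \<bullet> j) *\<^sub>R j))"
    using f by (intro bilinear_sum) (simp add: sym_bilinear_def)
  also have "\<dots> = (\<Sum>(i, j)\<in>Basis \<times> Basis. (x \<bullet> i) * (x \<bullet> j) * f i j)"
    by (simp add: sym_bilinear_simps[OF f] mult_ac)
  finally have "\<bar>f x x\<bar> \<le> (\<Sum>(i, j)\<in>Basis \<times> Basis. \<bar>(x \<bullet> i) * (x \<bullet> j) * f i j\<bar>)"
    by (simp add: sum_abs case_prod_unfold)
  also have "\<dots> \<le> (\<Sum>(i, j)\<in>(Basis::'a set) \<times> (Basis::'a set). e)"
  proof (rule sum_mono)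
    fix p :: "'a \<times> 'a" assume "p \<in> Basis \<times> Basis"
    then obtain i j where p: "p = (i, j)" and ij: "i \<in> Basis" "j \<in> Basis" by auto
    have "\<bar>x \<bullet> i\<bar> * \<bar>x \<bullet> j\<bar> \<le> 1 * 1"
      using Basis_le_norm[OF ij(1), of x] Basis_le_norm[OF ij(2), of x] x by (intro mult_mono) auto
    then have "\<bar>x \<bullet> i\<bar> * \<bar>x \<bullet> j\<bar> * \<bar>f i j\<bar> \<le> 1 * e"
      using le[OF ij] by (intro mult_mono) auto
    then show "(case p of (i, j) \<Rightarrow> \<bar>(x \<bullet> i) * (x \<bullet> j) * f i j\<bar>) \<le> (case p of (i, j) \<Rightarrow> e)"
      by (simp add: p abs_mult)
  qed
  also have "\<dots> = real (DIM('a)) * (real (DIM('a)) * e)"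
    by (simp add: card_cartesian_product)
  finally show ?thesis .
qed

lemma difference_quotient_uniform:
  fixes b :: "'t \<Rightarrow> 'a::euclidean_space \<Rightarrow> 'a \<Rightarrow> real"
  assumes b: "\<And>t. sym_bilinear (b t)" and b0: "sym_bilinear b0" and b': "sym_bilinear b'"
    and lim: "\<And>x y. ((\<lambda>t. (b t x y - b0 x y) / h t) \<longlongrightarrow> b' x y) F"
    and e: "0 < e"
  shows "\<forall>\<^sub>F t in F. \<forall>x. norm x = 1 \<longrightarrow> \<bar>(b t x x - b0 x x) / h t - b' x x\<bar> < e"
proof -
  \<comment> \<open>Entries smaller than this \<open>c\<close> make the bound of
    \<open>sym_bilinear_bound\<close> equal to \<open>e / 2\<close>.\<close>
  define c where "c = e / (2 * real DIM('a) * real DIM('a))"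
  have c: "c > 0" using e by (simp add: c_def)
  have "\<forall>\<^sub>F t in F. \<forall>i\<in>Basis. \<forall>j\<in>Basis. dist ((b t i j - b0 i j) / h t) (b' i j) < c"
    using lim c by (intro eventually_ball_finite ballI tendstoD) auto
  then show ?thesis
  proof eventually_elim
    case (elim t)
    let ?f = "\<lambda>x y. (b t x y - b0 x y) / h t - b' x y"
    have f: "sym_bilinear ?f"
      by (intro sym_bilinear_diff sym_bilinear_divide b b0 b')
    show ?case
    proof (intro allI impI)
      fix x :: 'a assume "norm x = 1"
      then have "\<bar>?f x x\<bar> \<le> real (DIM('a)) * (real (DIM('a)) * c)"
        using elim by (intro sym_bilinear_bound[OF f]) (auto simp: dist_real_def less_imp_le)
      also have "\<dots> = e / 2" by (simp add: c_def)
      finally show "\<bar>?f x x\<bar> < e" using e by simp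
    qed
  qed
qed

lemma sym_bilinear_continuous_on:
  fixes b :: "'a::euclidean_space \<Rightarrow> 'a \<Rightarrow> real"
  assumes "sym_bilinear b"
  shows "continuous_on S (\<lambda>x. b x x)"
proof -
  have "bounded_bilinear b"
    using assms bilinear_conv_bounded_bilinear by (auto simp: sym_bilinear_def)
  then show ?thesis
    by (intro bounded_bilinear.continuous_on[of b] continuous_on_id)
qed

text \<open>By compactness of the unit sphere of \<open>S\<close>, some \<open>C * b0 + b'\<close>
  is bounded below by \<open>m > 0\<close> there. Once \<open>h t < 1 / C\<close> and the difference
  quotient is within \<open>m\<close> of \<open>b'\<close>, the form \<open>b t\<close> exceeds
  \<open>b0 + h t * (b' - m)\<close>, which is at least \<open>h t * (C * b0 + b' - m)\<close> and
  hence nonnegative.\<close>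

lemma eventually_posdef_on:
  fixes b :: "'t \<Rightarrow> 'a::euclidean_space \<Rightarrow> 'a \<Rightarrow> real"
  assumes b: "\<And>t. sym_bilinear (b t)" and b0: "sym_bilinear b0" and b': "sym_bilinear b'"
    and lim: "\<And>x y. ((\<lambda>t. (b t x y - b0 x y) / h t) \<longlongrightarrow> b' x y) F"
    and h: "\<forall>\<^sub>F t in F. 0 < h t" "(h \<longlongrightarrow> 0) F"
    and S: "subspace S" and ge: "\<And>x. x \<in> S \<Longrightarrow> 0 \<le> b0 x x"
    and null: "\<And>x. x \<in> S \<Longrightarrow> x \<noteq> 0 \<Longrightarrow> b0 x x = 0 \<Longrightarrow> 0 < b' x x"
  shows "\<forall>\<^sub>F t in F. posdef_on (b t) S"
proof -
  define K where "K = S \<inter> sphere 0 1"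
  have K: "compact K" unfolding K_def
    by (intro closed_Int_compact closed_subspace S compact_sphere)
  have Kx: "x \<in> S" "x \<noteq> 0" "norm x = 1" if "x \<in> K" for x using that by (auto simp: K_def)
  note c0 = sym_bilinear_continuous_on[OF b0] and c' = sym_bilinear_continuous_on[OF b']
  \<comment> \<open>Only the compact set where \<open>b'\<close> is nonpositive needs care: there
    \<open>null\<close> forces \<open>b0\<close> to be positive, hence bounded away from
    zero.\<close>
  obtain C where C: "C > 0" "\<And>x. x \<in> K \<Longrightarrow> C * b0 x x + b' x x > 0"
  proof (cases "{x\<in>K. b' x x \<le> 0} = {}")
    case True
    show thesis
    proof (rule that[of 1])
      fix x assume x: "x \<in> K"
      then have "b' x x > 0" using True by force
      then show "1 * b0 x x + b' x x > 0" using ge[of x] Kx[OF x] by simp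
    qed auto
  next
    case False
    let ?Z = "{x\<in>K. b' x x \<le> 0}"
    have Z: "compact ?Z"
    proof -
      have "closed {x. b' x x \<le> 0}"
        using c'[of UNIV] by (intro closed_Collect_le) auto
      then have "compact (K \<inter> {x. b' x x \<le> 0})" using K by (rule compact_Int_closed[rotated])
      moreover have "?Z = K \<inter> {x. b' x x \<le> 0}" by auto
      ultimately show ?thesis by simp
    qed
    obtain x0 where x0: "x0 \<in> ?Z" "\<And>x. x \<in> ?Z \<Longrightarrow> b0 x0 x0 \<le> b0 x x"
      using continuous_attains_inf[OF Z False c0] by blast
    obtain x1 where x1: "x1 \<in> ?Z" "\<And>x. x \<in> ?Z \<Longrightarrow> b' x1 x1 \<le> b' x x"
      using continuous_attains_inf[OF Z False c'] by blast
    have p: "b0 x0 x0 > 0"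
      using ge[of x0] null[of x0] x0(1) Kx[of x0] by force
    \<comment> \<open>Chosen so that \<open>C\<close> times the minimum of \<open>b0\<close> plus
      the minimum of \<open>b'\<close> on \<open>?Z\<close> is 1.\<close>
    define C where "C = (1 - b' x1 x1) / b0 x0 x0"
    have C0: "C > 0" using p x1(1) by (simp add: C_def)
    show thesis
    proof (rule that[OF C0])
      fix x assume x: "x \<in> K"
      show "C * b0 x x + b' x x > 0"
      proof (cases "b' x x \<le> 0")
        case True
        then have "C * b0 x x \<ge> C * b0 x0 x0" "b' x x \<ge> b' x1 x1"
          using x0(2)[of x] x1(2)[of x] x C0 by auto
        moreover have "C * b0 x0 x0 = 1 - b' x1 x1" using p by (simp add: C_def)
        ultimately show ?thesis by linarith
      next
        case False
        then show ?thesis using C0 ge[of x] Kx[OF x] by (simp add: add_nonneg_pos)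
      qed
    qed
  qed
  obtain m where m: "m > 0" "\<And>x. x \<in> K \<Longrightarrow> C * b0 x x + b' x x \<ge> m"
  proof (cases "K = {}")
    case False
    have "continuous_on K (\<lambda>x. C * b0 x x + b' x x)"
      by (intro continuous_intros c0 c')
    from continuous_attains_inf[OF K False this] obtain x0 where
      "x0 \<in> K" "\<forall>x\<in>K. C * b0 x0 x0 + b' x0 x0 \<le> C * b0 x x + b' x x" by blast
    then show thesis using C that by blast
  qed (use that[of 1] in auto)
  have "\<forall>\<^sub>F t in F. h t < 1 / C" using order_tendstoD(2)[OF h(2)] C(1) by simp
  with difference_quotient_uniform[OF b b0 b' lim m(1)] h(1) show ?thesis
  proof eventually_elim
    case (elim t)
    have unit: "b t x x > 0" if x: "x \<in> K" for x
    proof -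
      have "(b t x x - b0 x x) / h t > b' x x - m"
        using elim(1) Kx[OF x] by (smt (verit))
      then have 1: "b t x x - b0 x x > h t * (b' x x - m)"
        using elim(2) by (simp add: field_simps)
      have "h t * C \<le> 1" using elim(3) C(1) by (simp add: field_simps)
      then have 2: "h t * C * b0 x x \<le> 1 * b0 x x"
        using ge[of x] Kx[OF x] by (intro mult_right_mono) auto
      have "h t * (C * b0 x x + b' x x - m) \<ge> 0" using m(2)[OF x] elim(2) by simp
      then show ?thesis using 1 2 by (simp add: algebra_simps)
    qed
    show ?case unfolding posdef_on_def
    proof (intro ballI impI)
      fix x assume x: "x \<in> S" "x \<noteq> 0"
      have "x /\<^sub>R norm x \<in> K" using x S by (auto simp: K_def subspace_scale)
      from unit[OF this] have "inverse (norm x) * (inverse (norm x) * b t x x) > 0"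
        by (simp add: sym_bilinear_simps[OF b])
      then show "b t x x > 0" using x(2) by (simp add: zero_less_mult_iff)
    qed
  qed
qed

text \<open>On a maximal positive subspace for \<open>b0\<close> plus \<open>N\<close>, the form
  \<open>b0\<close> is nonnegative and vanishes only on \<open>N\<close>, where the first-order term
  takes over; so this sum is eventually positive definite.\<close>

lemma eventually_pos_index_ge:
  fixes b :: "'t \<Rightarrow> 'a::euclidean_space \<Rightarrow> 'a \<Rightarrow> real"
  assumes b: "\<And>t. sym_bilinear (b t)" and b0: "sym_bilinear b0" and b': "sym_bilinear b'"
    and lim: "\<And>x y. ((\<lambda>t. (b t x y - b0 x y) / h t) \<longlongrightarrow> b' x y) F"
    and h: "\<forall>\<^sub>F t in F. 0 < h t" "(h \<longlongrightarrow> 0) F"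
    and E: "subspace E" and N: "subspace N" "N \<subseteq> form_radical E b0" "posdef_on b' N"
  shows "\<forall>\<^sub>F t in F. pos_index E b0 + dim N \<le> pos_index E (b t)"
proof -
  obtain P where P: "subspace P" "P \<subseteq> E" "posdef_on b0 P" "dim P = pos_index E b0"
    using pos_index_witness[OF E] .
  let ?S = "set_plus P N"
  have NE: "N \<subseteq> E" using N(2) by (auto simp: form_radical_def)
  have PN: "P \<inter> N \<subseteq> {0}" by (rule posdef_Int_radical[OF P(2,3) N(2)])
  note val = posdef_plus_radical[OF b0 P(2,3) N(2)]
  have "\<forall>\<^sub>F t in F. posdef_on (b t) ?S"
  proof (rule eventually_posdef_on[OF b b0 b' lim h])
    show "subspace ?S" using P N by (intro subspace_set_plus)
    fix x assume x: "x \<in> ?S"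
    then show "0 \<le> b0 x x" by (rule val(1))
    assume "x \<noteq> 0" "b0 x x = 0"
    then show "0 < b' x x" using val(2)[OF x] N(3) by (auto simp: posdef_on_def)
  qed
  then show ?thesis
  proof eventually_elim
    case (elim t)
    have "dim ?S \<le> pos_index E (b t)"
      using elim P N E NE by (intro pos_index_ge subspace_set_plus set_plus_subset) auto
    then show ?case using dim_set_plus_disjoint[OF P(1) N(1) PN] P(4) by simp
  qed
qed

text \<open>Both inertia indices can only increase, by at least the signature of the first-order
  perturbation on the radical; a radical of dimension \<open>d\<close> persists, so the total dimension leaves
  no room for more.\<close>

lemma eventually_pos_index_eq:
  fixes b :: "'t \<Rightarrow> 'a::euclidean_space \<Rightarrow> 'a \<Rightarrow> real"
  assumes b: "\<And>t. sym_bilinear (b t)" and b0: "sym_bilinear b0" and b': "sym_bilinear b'"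
    and lim: "\<And>x y. ((\<lambda>t. (b t x y - b0 x y) / h t) \<longlongrightarrow> b' x y) F"
    and h: "\<forall>\<^sub>F t in F. 0 < h t" "(h \<longlongrightarrow> 0) F"
    and E: "subspace E" and N1: "subspace N1" "N1 \<subseteq> form_radical E b0" "posdef_on b' N1"
    and N2: "subspace N2" "N2 \<subseteq> form_radical E b0" "posdef_on (\<lambda>x y. - b' x y) N2"
    and d: "dim (form_radical E b0) = d + dim N1 + dim N2"
    and dle: "\<forall>\<^sub>F t in F. d \<le> dim (form_radical E (b t))"
  shows "\<forall>\<^sub>F t in F. pos_index E (b t) = pos_index E b0 + dim N1 \<and> dim (form_radical E (b t)) = d"
proof -
  have lim': "((\<lambda>t. (- b t x y - - b0 x y) / h t) \<longlongrightarrow> - b' x y) F" for x y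
    using tendsto_minus[OF lim[of x y]] by (simp add: field_simps minus_divide_left)
  have "\<forall>\<^sub>F t in F. pos_index E b0 + dim N1 \<le> pos_index E (b t)"
    by (rule eventually_pos_index_ge[OF b b0 b' lim h E N1])
  moreover have "\<forall>\<^sub>F t in F. pos_index E (\<lambda>x y. - b0 x y) + dim N2 \<le> pos_index E (\<lambda>x y. - b t x y)"
    using N2 by (intro eventually_pos_index_ge[OF _ _ _ lim' h E])
      (auto simp: form_radical_uminus intro!: sym_bilinear_uminus b b0 b')
  ultimately show ?thesis using dle
  proof eventually_elim
    case (elim t)
    then show ?case
      using sylvester_inertia[OF b0 E] sylvester_inertia[OF b[of t] E] d by linarith
  qed
qed

section \<open>The Kashiwara form of three Lagrangians\<close>

lemma omega0_eq_inner_J0: "omega0 x y = J0 x \<bullet> y"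
  by (simp add: omega0_def J0_def inner_prod_def)

lemma J0_J0: "J0 (J0 x) = - x"
  by (simp add: J0_def prod_eq_iff)

lemma inner_J0_J0: "J0 x \<bullet> J0 y = x \<bullet> y"
  by (simp add: J0_def inner_prod_def)

lemma linear_J0: "linear J0"
  by (rule linearI) (auto simp: J0_def)

lemma inj_J0: "inj J0"
  by (rule injI) (auto simp: J0_def prod_eq_iff)

lemma omega0_simps:
  "omega0 (x + y) z = omega0 x z + omega0 y z" "omega0 x (y + z) = omega0 x y + omega0 x z"
  "omega0 (x - y) z = omega0 x z - omega0 y z" "omega0 x (y - z) = omega0 x y - omega0 x z"
  "omega0 (c *\<^sub>R x) y = c * omega0 x y" "omega0 x (c *\<^sub>R y) = c * omega0 x y"
  "omega0 0 x = 0" "omega0 x 0 = 0" "omega0 (- x) y = - omega0 x y" "omega0 x (- y) = - omega0 x y"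
  by (simp_all add: omega0_def inner_add_left inner_add_right inner_diff_left inner_diff_right
      algebra_simps)

lemma omega0_commute: "omega0 x y = - omega0 y x"
  by (simp add: omega0_def inner_commute)

lemma lagrangianD:
  assumes "lagrangian (L :: ((real^'n) \<times> (real^'n)) set)"
  shows "subspace L" "dim L = CARD('n)" "\<And>v w. v \<in> L \<Longrightarrow> w \<in> L \<Longrightarrow> omega0 v w = 0"
  using assms by (auto simp: lagrangian_def)

text \<open>The symplectic orthogonal of \<open>L\<close> is the Euclidean orthogonal of its image
  under \<open>J0\<close>. It contains \<open>L\<close> and has the same dimension, so it is
  \<open>L\<close>.\<close>

lemma lagrangian_maximal:
  fixes L :: "((real^'n) \<times> (real^'n)) set"
  assumes L: "lagrangian L" and v: "\<And>w. w \<in> L \<Longrightarrow> omega0 v w = 0"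
  shows "v \<in> L"
proof -
  let ?O = "{y \<in> UNIV. \<forall>x \<in> J0 ` L. orthogonal x y}"
  have S: "subspace (J0 ` L)" using linear_J0 lagrangianD(1)[OF L] by (rule linear_subspace_image)
  have "dim ?O + dim (J0 ` L) = dim (UNIV :: ((real^'n) \<times> (real^'n)) set)"
    by (rule dim_subspace_orthogonal_to_vectors) (use S in auto)
  moreover have "dim (J0 ` L) = CARD('n)"
    by (subst dim_image_eq[OF linear_J0])
      (auto simp: lagrangianD(2)[OF L] intro: inj_on_subset[OF inj_J0])
  ultimately have d: "dim ?O = dim L" using lagrangianD(2)[OF L] by (simp add: dim_UNIV)
  have "subspace ?O" by (auto simp: subspace_def orthogonal_def inner_add_right)
  moreover have "L \<subseteq> ?O"
    using lagrangianD(3)[OF L] by (auto simp: orthogonal_def omega0_eq_inner_J0)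
  ultimately have "L = ?O" using d lagrangianD(1)[OF L] by (intro subspace_dim_equal) auto
  moreover have "v \<in> ?O"
    using v omega0_commute[of v] by (auto simp: orthogonal_def omega0_eq_inner_J0)
  ultimately show ?thesis by blast
qed

text \<open>Polar form of the Kashiwara (Maslov triple) quadratic form: its diagonal is twice
  \<open>omega0 y x + omega0 z y + omega0 x z\<close>. The sign is such that crossings with the
  second slot raise the index forward in time.\<close>

definition kashiwara_form ::
  "((real^'n) \<times> (real^'n)) \<times> ((real^'n) \<times> (real^'n)) \<times> ((real^'n) \<times> (real^'n)) \<Rightarrow>
   ((real^'n) \<times> (real^'n)) \<times> ((real^'n) \<times> (real^'n)) \<times> ((real^'n) \<times> (real^'n)) \<Rightarrow> real" where
  "kashiwara_form = (\<lambda>(x, y, z) (x', y', z').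
     omega0 y x' + omega0 y' x + omega0 z y' + omega0 z' y + omega0 x z' + omega0 x' z)"

lemma sym_bilinear_kashiwara_form: "sym_bilinear kashiwara_form"
  unfolding sym_bilinear_def bilinear_def kashiwara_form_def
  by (simp add: linear_iff case_prod_unfold omega0_simps algebra_simps)

text \<open>Parametrizes the radical of the Kashiwara form: with \<open>a\<close>, \<open>b\<close>,
  \<open>c\<close> in \<open>A \<inter> B\<close>, \<open>A \<inter> C\<close>,
  \<open>B \<inter> C\<close>, the two summands of each entry share the Lagrangian of that
  slot.\<close>

definition pair_sums :: "'a::plus \<times> 'a \<times> 'a \<Rightarrow> 'a \<times> 'a \<times> 'a" where
  "pair_sums = (\<lambda>(a, b, c). (a + b, a + c, b + c))"

lemma linear_pair_sums: "linear (pair_sums :: 'a::real_vector \<times> 'a \<times> 'a \<Rightarrow> _)"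
  by (rule linearI) (auto simp: pair_sums_def algebra_simps)

lemma inj_pair_sums: "inj (pair_sums :: 'a::real_vector \<times> 'a \<times> 'a \<Rightarrow> _)"
proof -
  have "p = 0" if h: "pair_sums p = 0" for p :: "'a \<times> 'a \<times> 'a"
  proof -
    obtain a b c where p: "p = (a, b, c)" by (cases p)
    have e: "a + b = 0" "a + c = 0" "b + c = 0"
      using h by (auto simp: p pair_sums_def zero_prod_def)
    then have "b = c" by (metis add_left_cancel)
    then have "b = 0" using e(3) scaleR_2[of b] by simp
    then show "p = 0" using e(1) \<open>b = c\<close> by (simp add: p zero_prod_def)
  qed
  then show ?thesis using linear_injective_0[OF linear_pair_sums] by blast
qed

text \<open>Testing against one slot at a time shows that \<open>y - z\<close>,
  \<open>x - z\<close>, \<open>x - y\<close> are symplectically orthogonal to \<open>A\<close>,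
  \<open>B\<close>, \<open>C\<close>, hence lie in them by maximality.\<close>

lemma kashiwara_radical:
  assumes A: "lagrangian A" and B: "lagrangian B" and C: "lagrangian C"
  shows "form_radical (A \<times> B \<times> C) kashiwara_form =
    pair_sums ` ((A \<inter> B) \<times> (A \<inter> C) \<times> (B \<inter> C))" (is "?R = ?I")
proof
  note sA = lagrangianD(1)[OF A] and sB = lagrangianD(1)[OF B] and sC = lagrangianD(1)[OF C]
  show "?I \<subseteq> ?R"
  proof
    fix p assume "p \<in> ?I"
    then obtain a b c where p: "p = (a + b, a + c, b + c)"
      and a: "a \<in> A" "a \<in> B" and b: "b \<in> A" "b \<in> C" and c: "c \<in> B" "c \<in> C"
      by (auto simp: pair_sums_def)
    have "kashiwara_form p (x, y, z) = 0" if "x \<in> A" "y \<in> B" "z \<in> C" for x y z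
      using that a b c lagrangianD(3)[OF A] lagrangianD(3)[OF B] lagrangianD(3)[OF C]
        omega0_commute[of x c] omega0_commute[of y b] omega0_commute[of z a]
      by (simp add: p kashiwara_form_def omega0_simps)
    then show "p \<in> ?R"
      using a b c sA sB sC by (auto simp: form_radical_def p subspace_add)
  qed
  show "?R \<subseteq> ?I"
  proof
    fix p assume p: "p \<in> ?R"
    obtain x y z where p_eq: "p = (x, y, z)" by (cases p)
    have mem: "x \<in> A" "y \<in> B" "z \<in> C" using p by (auto simp: p_eq form_radical_def)
    have 0: "kashiwara_form (x, y, z) (x', y', z') = 0" if "x' \<in> A" "y' \<in> B" "z' \<in> C" for x' y' z'
      using p that by (auto simp: p_eq form_radical_def)
    note z = subspace_0[OF sA] subspace_0[OF sB] subspace_0[OF sC]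
    have yz: "y - z \<in> A"
    proof (rule lagrangian_maximal[OF A])
      fix w assume "w \<in> A"
      from 0[OF this z(2,3)] show "omega0 (y - z) w = 0"
        using omega0_commute[of w z] by (simp add: kashiwara_form_def omega0_simps)
    qed
    have xz: "x - z \<in> B"
    proof (rule lagrangian_maximal[OF B])
      fix w assume "w \<in> B"
      from 0[OF z(1) this z(3)] show "omega0 (x - z) w = 0"
        using omega0_commute[of w x] by (simp add: kashiwara_form_def omega0_simps)
    qed
    have xy: "x - y \<in> C"
    proof (rule lagrangian_maximal[OF C])
      fix w assume "w \<in> C"
      from 0[OF z(1,2) this] show "omega0 (x - y) w = 0"
        using omega0_commute[of w y] by (simp add: kashiwara_form_def omega0_simps)
    qed
    \<comment> \<open>The inverse of \<open>pair_sums\<close>. Membership of \<open>a\<close> in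
      both \<open>A\<close> and \<open>B\<close>, for instance, comes from reading
      \<open>x + y - z\<close> as \<open>x + (y - z)\<close> and as
      \<open>(x - z) + y\<close>.\<close>
    define a b c where "a = (1/2) *\<^sub>R (x + y - z)" and "b = (1/2) *\<^sub>R (x + z - y)"
      and "c = (1/2) *\<^sub>R (y + z - x)"
    have "x + y - z \<in> A" "x + z - y \<in> A" "x + y - z \<in> B" "y + z - x \<in> B"
      "x + z - y \<in> C" "y + z - x \<in> C"
      using subspace_add[OF sA mem(1) yz] subspace_diff[OF sA mem(1) yz]
        subspace_add[OF sB xz mem(2)] subspace_diff[OF sB mem(2) xz]
        subspace_add[OF sC xy mem(3)] subspace_diff[OF sC mem(3) xy] by (simp_all add: algebra_simps)
    then have "a \<in> A \<inter> B" "b \<in> A \<inter> C" "c \<in> B \<inter> C"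
      using sA sB sC unfolding a_def b_def c_def by (auto intro!: subspace_scale)
    moreover have "a + b = x" "a + c = y" "b + c = z"
      by (simp_all add: a_def b_def c_def scaleR_right_distrib[symmetric] scaleR_2[symmetric])
    ultimately show "p \<in> ?I"
      by (auto simp: p_eq pair_sums_def intro!: image_eqI[of _ _ "(a, b, c)"])
  qed
qed

lemma subspace_lagrangian_Times:
  assumes "lagrangian A" "lagrangian B" "lagrangian C"
  shows "subspace (A \<times> B \<times> C)"
  using assms by (intro subspace_Times lagrangianD(1))

lemma dim_Times3:
  fixes A :: "'a::euclidean_space set" and B :: "'b::euclidean_space set" and C :: "'c::euclidean_space set"
  assumes "subspace A" "subspace B" "subspace C"
  shows "dim (A \<times> B \<times> C) = dim A + dim B + dim C"
  using assms by (simp add: dim_Times subspace_Times)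

lemma dim_kashiwara_radical:
  assumes A: "lagrangian A" and B: "lagrangian B" and C: "lagrangian C"
  shows "dim (form_radical (A \<times> B \<times> C) kashiwara_form) =
    dim (A \<inter> B) + dim (A \<inter> C) + dim (B \<inter> C)"
proof -
  have "dim (pair_sums ` ((A \<inter> B) \<times> (A \<inter> C) \<times> (B \<inter> C))) = dim ((A \<inter> B) \<times> (A \<inter> C) \<times> (B \<inter> C))"
    by (rule dim_image_eq[OF linear_pair_sums]) (auto intro: inj_on_subset[OF inj_pair_sums])
  then show ?thesis
    using assms by (simp add: kashiwara_radical dim_Times3 subspace_inter lagrangianD(1))
qed

section \<open>Bounds and comparison for the Kashiwara index\<close>

abbreviation kashiwara_index ::
  "((real^'n) \<times> (real^'n)) set \<Rightarrow> ((real^'n) \<times> (real^'n)) set \<Rightarrow> ((real^'n) \<times> (real^'n)) set \<Rightarrow> nat" where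
  "kashiwara_index A B C \<equiv> pos_index (A \<times> B \<times> C) kashiwara_form"

text \<open>The isotropic \<open>V\<close> has dimension \<open>n\<close> and meets the radical in
  dimension at most \<open>dim (A \<inter> B \<inter> C)\<close>, so both inertia indices are at
  least \<open>n\<close> minus that number. For the positive index this gives the lower bounds; for
  the negative one, with Sylvester's law in dimension \<open>3 n\<close>, the upper bounds.\<close>

lemma kashiwara_index_bounds:
  fixes A B C :: "((real^'n) \<times> (real^'n)) set"
  assumes A: "lagrangian A" and B: "lagrangian B" and C: "lagrangian C"
  shows "CARD('n) \<le> kashiwara_index A B C + dim (A \<inter> B)"
    and "CARD('n) \<le> kashiwara_index A B C + dim (A \<inter> C)"
    and "kashiwara_index A B C + dim (A \<inter> B) + dim (set_plus (A \<inter> C) (B \<inter> C)) \<le> 2 * CARD('n)"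
    and "kashiwara_index A B C + dim (A \<inter> C) + dim (set_plus (A \<inter> B) (B \<inter> C)) \<le> 2 * CARD('n)"
proof -
  note sub = lagrangianD(1)[OF A] lagrangianD(1)[OF B] lagrangianD(1)[OF C]
  let ?E = "A \<times> B \<times> C" and ?b = kashiwara_form
  define V where "V = {0::(real^'n) \<times> (real^'n)} \<times> B \<times> {0::(real^'n) \<times> (real^'n)}"
  have E: "subspace ?E" by (rule subspace_lagrangian_Times[OF A B C])
  have V: "subspace V" "V \<subseteq> ?E" using sub by (auto simp: V_def subspace_Times subspace_0)
  have dV: "dim V = CARD('n)" using sub lagrangianD(2)[OF B] by (simp add: V_def dim_Times3)
  have iso: "?b x x = 0" if "x \<in> V" for x
    using that by (auto simp: V_def kashiwara_form_def omega0_simps)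
  have "V \<inter> form_radical ?E ?b \<subseteq> {0} \<times> (A \<inter> B \<inter> C) \<times> {0}"
  proof
    fix p assume "p \<in> V \<inter> form_radical ?E ?b"
    then obtain a b c where p: "p = (a + b, a + c, b + c)" "a + b = 0" "b + c = 0"
      "a \<in> A" "a \<in> B" "b \<in> A" "b \<in> C" "c \<in> B" "c \<in> C"
      by (auto simp: kashiwara_radical[OF A B C] V_def pair_sums_def)
    \<comment> \<open>The outer entries of a vector of \<open>V\<close> vanish, which forces
      \<open>a\<close> into all three Lagrangians.\<close>
    then have "b = - a" "c = a" by (auto simp: add_eq_0_iff)
    then show "p \<in> {0} \<times> (A \<inter> B \<inter> C) \<times> {0}" using p sub by (auto intro: subspace_add)
  qed
  then have "dim (V \<inter> form_radical ?E ?b) \<le> dim ({0::(real^'n) \<times> (real^'n)} \<times> (A \<inter> B \<inter> C) \<times> {0::(real^'n) \<times> (real^'n)})"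
    by (rule dim_subset)
  also have "\<dots> = dim (A \<inter> B \<inter> C)" using sub by (simp add: dim_Times3 subspace_inter)
  finally have r: "dim (V \<inter> form_radical ?E ?b) \<le> dim (A \<inter> B \<inter> C)" .
  have 1: "CARD('n) \<le> kashiwara_index A B C + dim (A \<inter> B \<inter> C)"
    using dim_nonneg_subspace_le[OF sym_bilinear_kashiwara_form E V] iso r dV by fastforce
  have 2: "CARD('n) \<le> pos_index ?E (\<lambda>x y. - ?b x y) + dim (A \<inter> B \<inter> C)"
    using dim_nonneg_subspace_le[OF sym_bilinear_uminus[OF sym_bilinear_kashiwara_form] E V]
      iso r dV by (fastforce simp: form_radical_uminus)
  have "dim (A \<inter> B \<inter> C) \<le> dim (A \<inter> B)" "dim (A \<inter> B \<inter> C) \<le> dim (A \<inter> C)"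
    by (auto intro: dim_subset)
  then show "CARD('n) \<le> kashiwara_index A B C + dim (A \<inter> B)"
    "CARD('n) \<le> kashiwara_index A B C + dim (A \<inter> C)" using 1 by linarith+
  have d: "dim ?E = 3 * CARD('n)"
    using sub lagrangianD(2)[OF A] lagrangianD(2)[OF B] lagrangianD(2)[OF C] by (simp add: dim_Times3)
  have "(A \<inter> C) \<inter> (B \<inter> C) = A \<inter> B \<inter> C" "(A \<inter> B) \<inter> (B \<inter> C) = A \<inter> B \<inter> C" by auto
  then have "dim (set_plus (A \<inter> C) (B \<inter> C)) + dim (A \<inter> B \<inter> C) = dim (A \<inter> C) + dim (B \<inter> C)"
    "dim (set_plus (A \<inter> B) (B \<inter> C)) + dim (A \<inter> B \<inter> C) = dim (A \<inter> B) + dim (B \<inter> C)"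
    using dim_set_plus_Int[of "A \<inter> C" "B \<inter> C"] dim_set_plus_Int[of "A \<inter> B" "B \<inter> C"] sub
    by (simp_all add: subspace_inter)
  then show "kashiwara_index A B C + dim (A \<inter> B) + dim (set_plus (A \<inter> C) (B \<inter> C)) \<le> 2 * CARD('n)"
    "kashiwara_index A B C + dim (A \<inter> C) + dim (set_plus (A \<inter> B) (B \<inter> C)) \<le> 2 * CARD('n)"
    using sylvester_inertia[OF sym_bilinear_kashiwara_form E] 2 d dim_kashiwara_radical[OF A B C]
    by linarith+
qed

text \<open>The forms for \<open>A\<close> and \<open>A'\<close> coincide on \<open>(A \<inter> A') \<times> B \<times> C\<close>, which has codimension
  \<open>n - dim (A \<inter> A')\<close> in either domain.\<close>

lemma kashiwara_index_compare:
  fixes A A' B C :: "((real^'n) \<times> (real^'n)) set"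
  assumes A: "lagrangian A" and A': "lagrangian A'" and B: "lagrangian B" and C: "lagrangian C"
    and N: "subspace N" "N \<subseteq> form_radical (A \<times> B \<times> C) kashiwara_form"
  shows "kashiwara_index A B C + dim N + dim (A \<inter> A') \<le>
    kashiwara_index A' B C + CARD('n) + dim (N \<inter> ((A \<inter> A') \<times> B \<times> C))"
proof -
  note sub = lagrangianD(1)[OF A] lagrangianD(1)[OF A'] lagrangianD(1)[OF B] lagrangianD(1)[OF C]
  note b = sym_bilinear_kashiwara_form
  let ?E = "A \<times> B \<times> C" and ?E' = "A' \<times> B \<times> C" and ?D = "(A \<inter> A') \<times> B \<times> C" and ?b = kashiwara_form
  have E: "subspace ?E" "subspace ?E'" "subspace ?D"
    using sub by (auto intro!: subspace_Times subspace_inter)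
  obtain P where P: "subspace P" "P \<subseteq> ?E" "posdef_on ?b P" "dim P = kashiwara_index A B C"
    using pos_index_witness[OF E(1)] .
  have NE: "N \<subseteq> ?E" using N(2) by (auto simp: form_radical_def)
  have PN: "P \<inter> N \<subseteq> {0}" by (rule posdef_Int_radical[OF P(2,3) N(2)])
  note val = posdef_plus_radical[OF b P(2,3) N(2)]
  \<comment> \<open>Adding \<open>N\<close> keeps the form nonnegative while enlarging the
    dimension. On the common domain the vectors of \<open>?S\<close> may be measured by the form for
    \<open>A'\<close>, and those that are null lie in \<open>N\<close>.\<close>
  let ?S = "set_plus P N \<inter> ?D"
  have "dim (set_plus P N) + dim ?D \<le> dim ?E + dim ?S"
    using P N NE E by (intro dim_Int_ge subspace_set_plus set_plus_subset) auto
  moreover have "dim (set_plus P N) = dim P + dim N" by (rule dim_set_plus_disjoint[OF P(1) N(1) PN])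
  moreover have "dim ?D = dim (A \<inter> A') + 2 * CARD('n)" "dim ?E = 3 * CARD('n)"
    using sub lagrangianD(2)[OF A] lagrangianD(2)[OF B] lagrangianD(2)[OF C]
    by (simp_all add: dim_Times3 subspace_inter)
  moreover have "dim ?S \<le> kashiwara_index A' B C + dim (?S \<inter> form_radical ?E' ?b)"
    using val P N E by (intro dim_nonneg_subspace_le[OF b E(2)] subspace_inter subspace_set_plus) auto
  moreover have "?S \<inter> form_radical ?E' ?b \<subseteq> N \<inter> ?D"
    using val by (fastforce simp: form_radical_def)
  then have "dim (?S \<inter> form_radical ?E' ?b) \<le> dim (N \<inter> ?D)" by (rule dim_subset)
  ultimately show ?thesis using P(4) by linarith
qed

text \<open>Images of \<open>(a, 0, 0)\<close> and \<open>(0, a, 0)\<close> under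
  \<open>pair_sums\<close>. These are the radical directions created by crossings with
  \<open>B\<close> and with \<open>C\<close>.\<close>

lemma diagonal_in_radical:
  assumes A: "lagrangian A" and B: "lagrangian B" and C: "lagrangian C"
  shows "(\<lambda>a. (a, a, 0)) ` (A \<inter> B) \<subseteq> form_radical (A \<times> B \<times> C) kashiwara_form"
    and "(\<lambda>a. (a, 0, a)) ` (A \<inter> C) \<subseteq> form_radical (A \<times> B \<times> C) kashiwara_form"
proof -
  note sub = lagrangianD(1)[OF A] lagrangianD(1)[OF B] lagrangianD(1)[OF C]
  show "(\<lambda>a. (a, a, 0)) ` (A \<inter> B) \<subseteq> form_radical (A \<times> B \<times> C) kashiwara_form"
    unfolding kashiwara_radical[OF A B C] pair_sums_def
    using sub by (force simp: subspace_0 intro!: image_eqI[of _ _ "(x, 0, 0)" for x])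
  show "(\<lambda>a. (a, 0, a)) ` (A \<inter> C) \<subseteq> form_radical (A \<times> B \<times> C) kashiwara_form"
    unfolding kashiwara_radical[OF A B C] pair_sums_def
    using sub by (force simp: subspace_0 intro!: image_eqI[of _ _ "(0, x, 0)" for x])
qed

lemma diagonal_subspaces:
  fixes S :: "'a::euclidean_space set"
  assumes "subspace S"
  shows "subspace ((\<lambda>a. (a, a, 0::'a)) ` S)" "dim ((\<lambda>a. (a, a, 0::'a)) ` S) = dim S"
    "subspace ((\<lambda>a. (a, 0::'a, a)) ` S)" "dim ((\<lambda>a. (a, 0::'a, a)) ` S) = dim S"
proof -
  have l: "linear (\<lambda>a::'a. (a, a, 0::'a))" "linear (\<lambda>a::'a. (a, 0::'a, a))"
    by (auto intro!: linearI)
  show "subspace ((\<lambda>a. (a, a, 0::'a)) ` S)" "subspace ((\<lambda>a. (a, 0::'a, a)) ` S)"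
    using l assms by (auto intro: linear_subspace_image)
  show "dim ((\<lambda>a. (a, a, 0::'a)) ` S) = dim S" "dim ((\<lambda>a. (a, 0::'a, a)) ` S) = dim S"
    by (rule dim_image_eq[OF l(1)], simp add: inj_on_def)
      (rule dim_image_eq[OF l(2)], simp add: inj_on_def)
qed

text \<open>Takes for \<open>N\<close> the diagonal copy of \<open>A \<inter> B\<close> or
  \<open>A \<inter> C\<close>; its part in the common domain is the copy of the triple intersection.
  This is where the numbers \<open>e1\<close> and \<open>e2\<close> come from.\<close>

lemma kashiwara_index_compare_common:
  fixes A A' B C :: "((real^'n) \<times> (real^'n)) set"
  assumes A: "lagrangian A" and A': "lagrangian A'" and B: "lagrangian B" and C: "lagrangian C"
  shows "kashiwara_index A B C + dim (A \<inter> B) + dim (A \<inter> A') \<le>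
      kashiwara_index A' B C + CARD('n) + dim (A \<inter> A' \<inter> B)"
    and "kashiwara_index A B C + dim (A \<inter> C) + dim (A \<inter> A') \<le>
      kashiwara_index A' B C + CARD('n) + dim (A \<inter> A' \<inter> C)"
proof -
  note sub = lagrangianD(1)[OF A] lagrangianD(1)[OF A'] lagrangianD(1)[OF B] lagrangianD(1)[OF C]
  note sAB = subspace_inter[OF sub(1,3)] and sAC = subspace_inter[OF sub(1,4)]
  have s3: "subspace (A \<inter> A' \<inter> B)" "subspace (A \<inter> A' \<inter> C)" using sub by (auto intro: subspace_inter)
  have "(\<lambda>a. (a, a, 0)) ` (A \<inter> B) \<inter> ((A \<inter> A') \<times> B \<times> C) = (\<lambda>a. (a, a, 0)) ` (A \<inter> A' \<inter> B)"
    "(\<lambda>a. (a, 0, a)) ` (A \<inter> C) \<inter> ((A \<inter> A') \<times> B \<times> C) = (\<lambda>a. (a, 0, a)) ` (A \<inter> A' \<inter> C)"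
    using sub by (auto simp: subspace_0)
  then show "kashiwara_index A B C + dim (A \<inter> B) + dim (A \<inter> A') \<le>
      kashiwara_index A' B C + CARD('n) + dim (A \<inter> A' \<inter> B)"
    "kashiwara_index A B C + dim (A \<inter> C) + dim (A \<inter> A') \<le>
      kashiwara_index A' B C + CARD('n) + dim (A \<inter> A' \<inter> C)"
    using kashiwara_index_compare[OF assms diagonal_subspaces(1)[OF sAB] diagonal_in_radical(1)[OF A B C]]
      kashiwara_index_compare[OF assms diagonal_subspaces(3)[OF sAC] diagonal_in_radical(2)[OF A B C]]
      diagonal_subspaces(2)[OF sAB] diagonal_subspaces(4)[OF sAC]
      diagonal_subspaces(2)[OF s3(1)] diagonal_subspaces(4)[OF s3(2)]
    by simp_all
qed

section \<open>Jumps along a Hamiltonian flow\<close>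

text \<open>Infinitely many nonzero values would accumulate in the compact interval, against local
  vanishing.\<close>

lemma finite_jump_set:
  fixes d :: "real \<Rightarrow> nat"
  assumes "\<And>s. s \<in> {0..T} \<Longrightarrow> \<forall>\<^sub>F t in at s within {0..T}. d t = 0"
  shows "finite {t\<in>{0..T}. d t \<noteq> 0}"
proof -
  have "finite ({0..T} \<inter> {t\<in>{0..T}. d t \<noteq> 0})"
  proof (rule finite_not_islimpt_in_compact)
    fix s assume "s \<in> {0..T}"
    from assms[OF this] show "\<not> s islimpt {t\<in>{0..T}. d t \<noteq> 0}"
      unfolding islimpt_iff_eventually eventually_at_filter not_not
      by (auto elim!: eventually_mono)
  qed auto
  then show ?thesis by (auto elim: finite_subset[rotated])
qed

text \<open>Subtracting from \<open>f\<close> its accumulated jumps gives a locally constant function.\<close>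

lemma jump_sum:
  fixes f d1 d2 :: "real \<Rightarrow> nat"
  assumes T: "0 < T"
    and iso: "\<And>s. s \<in> {0..T} \<Longrightarrow> \<forall>\<^sub>F t in at s within {0..T}. d1 t = 0 \<and> d2 t = 0"
    and jump: "\<And>s. s \<in> {0..T} \<Longrightarrow> \<forall>\<^sub>F t in at s within {0..T}.
      (s < t \<longrightarrow> f t = f s + d1 s) \<and> (t < s \<longrightarrow> f t = f s + d2 s)"
  shows "int (\<Sum>t\<in>{t\<in>{0..T}. d1 t \<noteq> 0}. d1 t) - int (\<Sum>t\<in>{t\<in>{0..T}. d2 t \<noteq> 0}. d2 t) =
    int (f T + d1 T) - int (f 0 + d2 0)"
proof -
  define C where "C = {t\<in>{0..T}. d1 t + d2 t \<noteq> 0}"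
  \<comment> \<open>Without finiteness the sums in the conclusion would take the default value
    0.\<close>
  have finC: "finite C" unfolding C_def
    using iso by (intro finite_jump_set) (auto elim: eventually_mono)
  define D where "D t = int (d1 t) - int (d2 t)" for t
  \<comment> \<open>\<open>f s + d1 s\<close> is the value of \<open>f\<close> just to the right of
    \<open>s\<close>, and \<open>D s\<close> is the total jump across \<open>s\<close> from left to
    right, so \<open>g\<close> is unaffected by jumps.\<close>
  define g where "g s = int (f s) + int (d1 s) - (\<Sum>t\<in>{t\<in>C. t \<le> s}. D t)" for s
  have "g 0 = g T"
  proof (rule connected_local_const[of "{0..T}"], intro connected_Icc, goal_cases)
    case 3
    show ?case
    proof
      fix s assume s: "s \<in> {0..T}"
      have "\<forall>\<^sub>F t in at s within {0..T}. (d1 t = 0 \<and> d2 t = 0) \<and>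
          (s < t \<longrightarrow> f t = f s + d1 s) \<and> (t < s \<longrightarrow> f t = f s + d2 s)"
        using iso[OF s] jump[OF s] by eventually_elim auto
      then obtain e where e: "e > 0" and near: "\<And>t. t \<in> {0..T} \<Longrightarrow> t \<noteq> s \<Longrightarrow> dist t s < e \<Longrightarrow>
          (d1 t = 0 \<and> d2 t = 0) \<and> (s < t \<longrightarrow> f t = f s + d1 s) \<and> (t < s \<longrightarrow> f t = f s + d2 s)"
        unfolding eventually_at by auto
      have "g s = g t" if t: "t \<in> {0..T}" "t \<noteq> s" "dist t s < e" for t
      proof -
        have Cn: "u \<notin> C" if "u \<noteq> s" "dist u s < e" for u
          using near[of u] that by (auto simp: C_def)
        show ?thesis
        proof (cases "s < t")
          case True
          have "u \<le> s" if "u \<in> C" "u \<le> t" for u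
            using Cn[of u] that t True by (cases "u \<le> s") (auto simp: dist_real_def)
          then have "{u\<in>C. u \<le> t} = {u\<in>C. u \<le> s}" using True by auto
          then show ?thesis using near[OF t] True by (simp add: g_def)
        next
          case False
          then have ts: "t < s" using t by simp
          have "u \<le> t \<or> u = s" if "u \<in> C" "u \<le> s" for u
            using Cn[of u] that t ts by (cases "u \<le> t") (auto simp: dist_real_def)
          then have eq: "{u\<in>C. u \<le> s} - {s} = {u\<in>C. u \<le> t} - {s}" using ts by auto
          \<comment> \<open>If \<open>s\<close> is not in \<open>C\<close> then
            \<open>D s = 0\<close>, so adjoining \<open>s\<close> does not change the sum.\<close>
          have "(\<Sum>u\<in>{u\<in>C. u \<le> s}. D u) = (\<Sum>u\<in>{u\<in>C. u \<le> s} \<union> {s}. D u)"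
          proof (rule sum.mono_neutral_left)
            show "finite ({u\<in>C. u \<le> s} \<union> {s})" using finC by simp
          qed (use s in \<open>auto simp: C_def D_def\<close>)
          also have "\<dots> = D s + (\<Sum>u\<in>{u\<in>C. u \<le> s} - {s}. D u)"
            using finC by (simp add: sum.insert_remove)
          also have "{u\<in>C. u \<le> s} - {s} = {u\<in>C. u \<le> t}" using eq ts by auto
          finally show ?thesis using near[OF t] ts by (simp add: g_def D_def)
        qed
      qed
      then show "\<forall>\<^sub>F t in at s within {0..T}. g s = g t"
        using e unfolding eventually_at by blast
    qed
  qed (use T in auto)
  moreover have "g 0 = int (f 0 + d2 0)"
  proof -
    \<comment> \<open>The jump at 0 is already subtracted, which replaces \<open>d1 0\<close> by
      \<open>d2 0\<close>.\<close>
    have "(\<Sum>t\<in>{t\<in>C. t \<le> 0}. D t) = (\<Sum>t\<in>{0}. D t)"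
      using T by (intro sum.mono_neutral_left) (auto simp: C_def D_def)
    then show ?thesis by (simp add: g_def D_def)
  qed
  moreover have "(\<Sum>t\<in>{t\<in>{0..T}. d1 t \<noteq> 0}. d1 t) = (\<Sum>t\<in>C. d1 t)"
    by (rule sum.mono_neutral_left) (use finC in \<open>auto simp: C_def\<close>)
  moreover have "(\<Sum>t\<in>{t\<in>{0..T}. d2 t \<noteq> 0}. d2 t) = (\<Sum>t\<in>C. d2 t)"
    by (rule sum.mono_neutral_left) (use finC in \<open>auto simp: C_def\<close>)
  moreover have "{t\<in>C. t \<le> T} = C" by (auto simp: C_def)
  ultimately show ?thesis by (simp add: g_def D_def sum_subtractf)
qed

section \<open>Difference quotients, symplectic maps and transversality\<close>

lemma has_vector_derivative_quotient:
  fixes f :: "real \<Rightarrow> 'a::real_normed_vector"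
  assumes "(f has_vector_derivative f') (at x within S)"
  shows "((\<lambda>y. (f y - f x) /\<^sub>R (y - x)) \<longlongrightarrow> f') (at x within S)"
proof -
  have "((\<lambda>y. (1 / norm (y - x)) *\<^sub>R (f y - (f x + (y - x) *\<^sub>R f'))) \<longlongrightarrow> 0) (at x within S)"
    using assms by (simp add: has_vector_derivative_def has_derivative_within)
  then have "((\<lambda>y. norm ((1 / norm (y - x)) *\<^sub>R (f y - (f x + (y - x) *\<^sub>R f')))) \<longlongrightarrow> 0) (at x within S)"
    by (rule tendsto_norm_zero)
  moreover have "\<forall>\<^sub>F y in at x within S. norm ((1 / norm (y - x)) *\<^sub>R (f y - (f x + (y - x) *\<^sub>R f'))) =
      norm ((f y - f x) /\<^sub>R (y - x) - f')"
  proof (unfold eventually_at_filter, intro always_eventually allI impI)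
    fix y assume "y \<noteq> x"
    then have "(1 / (y - x)) *\<^sub>R ((f y - f x) - (y - x) *\<^sub>R f') = (f y - f x) /\<^sub>R (y - x) - f'"
      by (subst scaleR_diff_right) (simp add: inverse_eq_divide)
    then have "(f y - f x) /\<^sub>R (y - x) - f' = (1 / (y - x)) *\<^sub>R (f y - (f x + (y - x) *\<^sub>R f'))"
      by (simp only: diff_diff_eq)
    then show "norm ((1 / norm (y - x)) *\<^sub>R (f y - (f x + (y - x) *\<^sub>R f'))) =
      norm ((f y - f x) /\<^sub>R (y - x) - f')" by simp
  qed
  ultimately have "((\<lambda>y. norm ((f y - f x) /\<^sub>R (y - x) - f')) \<longlongrightarrow> 0) (at x within S)"
    by (rule Lim_transform_eventually)
  then show ?thesis by (subst Lim_null) (rule tendsto_norm_zero_cancel)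
qed

lemma bounded_bilinear_omega0: "bounded_bilinear omega0"
  unfolding bilinear_conv_bounded_bilinear[symmetric] bilinear_def
  by (simp add: linear_iff omega0_simps)

text \<open>Nondegeneracy: \<open>omega0 x (J0 x)\<close> is the squared norm of
  \<open>x\<close>.\<close>

lemma symplectic_inj:
  assumes g: "linear g" "\<And>x y. omega0 (g x) (g y) = omega0 x y"
  shows "inj g"
proof -
  have "x = 0" if "g x = 0" for x
  proof -
    have "omega0 x (J0 x) = 0" using g(2)[of x "J0 x"] that by (simp add: omega0_simps)
    then have "x \<bullet> x = 0" by (simp only: omega0_eq_inner_J0 inner_J0_J0)
    then show "x = 0" by simp
  qed
  then show ?thesis using linear_injective_0[OF g(1)] by blast
qed

lemma lagrangian_image:
  fixes g :: "((real^'n) \<times> (real^'n)) \<Rightarrow> ((real^'n) \<times> (real^'n))"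
  assumes g: "linear g" "\<And>x y. omega0 (g x) (g y) = omega0 x y" and L: "lagrangian L"
  shows "lagrangian (g ` L)"
proof -
  have "dim (g ` L) = dim L"
    by (rule dim_image_eq[OF g(1)]) (auto intro: inj_on_subset[OF symplectic_inj[OF g]])
  then show ?thesis
    using L linear_subspace_image[OF g(1)] by (auto simp: lagrangian_def g(2))
qed

text \<open>By Pythagoras \<open>norm (f x + w)\<close> dominates both \<open>norm (f x)\<close> and
  \<open>norm w\<close>, and passing from \<open>f\<close> to \<open>g\<close> costs at most half of
  it. Used to keep \<open>l t\<close> transversal to the orthogonal complement of
  \<open>l t0\<close>, with control of the components.\<close>

lemma transversal_perturbation:
  fixes f g :: "'a::real_normed_vector \<Rightarrow> 'b::real_inner"
  assumes c: "0 < c" "c * norm x \<le> norm (f x)" and near: "norm (g x - f x) \<le> c / 2 * norm x"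
    and orth: "f x \<bullet> w = 0"
  shows "c / 2 * norm x \<le> norm (g x + w)" and "norm w \<le> 2 * norm (g x + w)"
proof -
  have sq: "(norm (f x + w))\<^sup>2 = (norm (f x))\<^sup>2 + (norm w)\<^sup>2"
    using orth by (simp add: power2_norm_eq_inner inner_add_left inner_add_right inner_commute)
  then have "norm (f x) \<le> norm (f x + w)" "norm w \<le> norm (f x + w)"
    by (auto intro: power2_le_imp_le)
  moreover have "norm (f x + w) \<le> norm (g x + w) + norm (g x - f x)"
    using norm_triangle_ineq4[of "g x + w" "g x - f x"] by (simp add: algebra_simps)
  ultimately show "c / 2 * norm x \<le> norm (g x + w)" "norm w \<le> 2 * norm (g x + w)"
    using c near by (auto simp: field_simps)
qed

section \<open>The Hamiltonian flow and its crossing forms\<close>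

locale hamiltonian_flow =
  fixes T :: real
    and B \<psi> :: "real \<Rightarrow> ((real^'n) \<times> (real^'n)) \<Rightarrow>\<^sub>L ((real^'n) \<times> (real^'n))"
    and L :: "((real^'n) \<times> (real^'n)) set"
  assumes T: "0 < T"
    and B_sym: "\<And>t. t \<in> {0..T} \<Longrightarrow> symmetric_op (B t)"
    and psi0: "\<psi> 0 = id_blinfun"
    and psi_ode: "\<And>t z. t \<in> {0..T} \<Longrightarrow>
       ((\<lambda>s. blinfun_apply (\<psi> s) z) has_vector_derivative
          J0 (blinfun_apply (B t) (blinfun_apply (\<psi> t) z))) (at t within {0..T})"
    and LL: "lagrangian L"
begin

abbreviation l :: "real \<Rightarrow> ((real^'n) \<times> (real^'n)) set" where
  "l t \<equiv> blinfun_apply (\<psi> t) ` L"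

lemma linear_psi: "linear (blinfun_apply (\<psi> t))"
  by (simp add: bounded_linear.linear blinfun.bounded_linear_right)

text \<open>The derivative of the left side is \<open>B\<close> paired in two ways with opposite
  signs, and cancels because \<open>B t\<close> is symmetric.\<close>

lemma symplectic:
  assumes "t \<in> {0..T}"
  shows "omega0 (\<psi> t x) (\<psi> t y) = omega0 x y"
proof -
  have "\<exists>c. \<forall>t\<in>{0..T}. omega0 (\<psi> t x) (\<psi> t y) = c"
  proof (rule has_derivative_zero_constant)
    fix t assume t: "t \<in> {0..T}"
    have "((\<lambda>t. omega0 (\<psi> t x) (\<psi> t y)) has_vector_derivative
        omega0 (\<psi> t x) (J0 (B t (\<psi> t y))) + omega0 (J0 (B t (\<psi> t x))) (\<psi> t y)) (at t within {0..T})"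
      by (rule bounded_bilinear.has_vector_derivative[OF bounded_bilinear_omega0 psi_ode[OF t] psi_ode[OF t]])
    moreover have "omega0 (\<psi> t x) (J0 (B t (\<psi> t y))) + omega0 (J0 (B t (\<psi> t x))) (\<psi> t y) = 0"
    proof -
      have "B t (\<psi> t x) \<bullet> \<psi> t y = \<psi> t x \<bullet> B t (\<psi> t y)"
        using B_sym[OF t] unfolding symmetric_op_def by blast
      then show ?thesis by (simp add: omega0_eq_inner_J0 inner_J0_J0 J0_J0)
    qed
    ultimately show "((\<lambda>t. omega0 (\<psi> t x) (\<psi> t y)) has_derivative (\<lambda>h. 0)) (at t within {0..T})"
      by (simp add: has_vector_derivative_def)
  qed simp
  moreover have "0 \<in> {0..T}" using T by simp
  ultimately have "omega0 (\<psi> t x) (\<psi> t y) = omega0 (\<psi> 0 x) (\<psi> 0 y)" using assms by metis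
  then show ?thesis by (simp add: psi0)
qed

lemma inj_psi: "t \<in> {0..T} \<Longrightarrow> inj (blinfun_apply (\<psi> t))"
  using symplectic_inj[OF linear_psi] symplectic by blast

lemma lagrangian_l: "t \<in> {0..T} \<Longrightarrow> lagrangian (l t)"
  using lagrangian_image[OF linear_psi _ LL] symplectic by blast

text \<open>Pointwise continuity upgrades to the operator norm in finite dimension.\<close>

lemma psi_tendsto:
  assumes "t0 \<in> {0..T}"
  shows "((\<lambda>t. norm (\<psi> t - \<psi> t0)) \<longlongrightarrow> 0) (at t0 within {0..T})"
proof -
  have "(\<psi> \<longlongrightarrow> \<psi> t0) (at t0 within {0..T})"
  proof (rule tendsto_componentwise1)
    fix j show "((\<lambda>t. \<psi> t j) \<longlongrightarrow> \<psi> t0 j) (at t0 within {0..T})"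
      using has_vector_derivative_continuous[OF psi_ode[OF assms]] by (simp add: continuous_within)
  qed
  then show ?thesis using LIM_zero tendsto_norm_zero by blast
qed

text \<open>With \<open>v = \<psi> t0 u\<close>, both \<open>v + w t\<close> and
  \<open>\<psi> t u\<close> lie in the Lagrangian \<open>l t\<close>, so
  \<open>omega0 v (w t) = omega0 (v + w t) (\<psi> t u - v)\<close>. Dividing by
  \<open>t - t0\<close> and using that \<open>w t\<close> tends to 0 leaves
  \<open>omega0 v (J0 (B t0 v))\<close>.\<close>

lemma crossing_derivative:
  assumes t0: "t0 \<in> {0..T}" and v: "v \<in> l t0"
  shows "((\<lambda>t. omega0 v (THE w. w \<in> J0 ` l t0 \<and> v + w \<in> l t)) has_real_derivative v \<bullet> B t0 v)
    (at t0 within {0..T})"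
proof -
  let ?W = "J0 ` l t0"
  define w where "w t = (THE w. w \<in> ?W \<and> v + w \<in> l t)" for t
  note lag = lagrangian_l[OF t0]
  have W: "subspace ?W" "dim ?W = CARD('n)"
  proof -
    show "subspace ?W" using linear_J0 lagrangianD(1)[OF lag] by (rule linear_subspace_image)
    show "dim ?W = CARD('n)"
      by (subst dim_image_eq[OF linear_J0])
        (auto simp: lagrangianD(2)[OF lag] intro: inj_on_subset[OF inj_J0])
  qed
  have orth: "\<psi> t0 x \<bullet> y = 0" if x: "x \<in> L" and y: "y \<in> ?W" for x y
  proof -
    obtain a where a: "y = J0 a" "a \<in> l t0" using y by blast
    have "omega0 a (\<psi> t0 x) = 0" using lagrangianD(3)[OF lag a(2)] x by blast
    then show ?thesis by (simp add: a(1) omega0_eq_inner_J0 inner_commute)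
  qed
  obtain u where u: "u \<in> L" "v = \<psi> t0 u" using v by auto
  obtain c where c: "c > 0" "\<And>x. c * norm x \<le> norm (\<psi> t0 x)"
    using linear_inj_bounded_below_pos[OF linear_psi inj_psi[OF t0]] by blast
  \<comment> \<open>Near \<open>t0\<close> the space \<open>l t\<close> stays complementary to
    \<open>?W\<close>, so the description of \<open>w t\<close> denotes a vector, and one that is
    small with \<open>\<psi> t - \<psi> t0\<close>.\<close>
  have w: "w t \<in> ?W \<and> v + w t \<in> l t \<and> norm (w t) \<le> 2 * (norm (\<psi> t - \<psi> t0) * norm u)"
    if t: "t \<in> {0..T}" and near: "norm (\<psi> t - \<psi> t0) \<le> c / 2" for t
  proof -
    note lt = lagrangian_l[OF t]
    have diff: "norm (\<psi> t x - \<psi> t0 x) \<le> norm (\<psi> t - \<psi> t0) * norm x" for x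
      using norm_blinfun[of "\<psi> t - \<psi> t0" x] by (simp add: blinfun.diff_left)
    have pert: "c / 2 * norm x \<le> norm (\<psi> t x + y)" "norm y \<le> 2 * norm (\<psi> t x + y)"
      if "x \<in> L" "y \<in> ?W" for x y
    proof -
      have "norm (\<psi> t x - \<psi> t0 x) \<le> c / 2 * norm x"
        using diff[of x] mult_right_mono[OF near norm_ge_zero[of x]] by linarith
      from transversal_perturbation[of c x "blinfun_apply (\<psi> t0)" "blinfun_apply (\<psi> t)" y, OF c(1) c(2) this orth[OF that]]
      show "c / 2 * norm x \<le> norm (\<psi> t x + y)" "norm y \<le> 2 * norm (\<psi> t x + y)" .
    qed
    have triv: "l t \<inter> ?W \<subseteq> {0}"
    proof
      fix y assume y: "y \<in> l t \<inter> ?W"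
      then obtain x where x: "x \<in> L" "y = \<psi> t x" by auto
      have "norm (- y) \<le> 2 * norm (\<psi> t x + - y)"
        using x y W(1) by (intro pert(2)) (auto intro: subspace_neg)
      then show "y \<in> {0}" by (simp add: x)
    qed
    have "dim (set_plus (l t) ?W) = DIM((real^'n) \<times> (real^'n))"
      using dim_set_plus_disjoint[OF lagrangianD(1)[OF lt] W(1) triv] W(2) lagrangianD(2)[OF lt] by simp
    then have "set_plus (l t) ?W = UNIV"
      using subspace_set_plus[OF lagrangianD(1)[OF lt] W(1)] dim_eq_full span_eq_iff by blast
    then have "v \<in> set_plus (l t) ?W" by simp
    then obtain x y where xy: "v = \<psi> t x + y" "x \<in> L" "y \<in> ?W" unfolding set_plus_def by blast
    have ex: "- y \<in> ?W \<and> v + - y \<in> l t" using xy W(1) by (auto intro: subspace_neg)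
    moreover have "z = - y" if "z \<in> ?W \<and> v + z \<in> l t" for z
    proof -
      have "(v + z) - (v + - y) \<in> l t" using that ex lagrangianD(1)[OF lt] by (blast intro: subspace_diff)
      moreover have "z - - y \<in> ?W" using that ex W(1) by (blast intro: subspace_diff)
      ultimately have "z - - y \<in> {0}" using triv by auto
      then show ?thesis by (simp add: eq_neg_iff_add_eq_0)
    qed
    ultimately have wt: "w t = - y" unfolding w_def by (intro the_equality) auto
    \<comment> \<open>Using \<open>x - u\<close> instead of \<open>x\<close> makes the perturbed sum
      equal to \<open>v - \<psi> t u\<close>, which is small.\<close>
    have "norm y \<le> 2 * norm (\<psi> t (x - u) + y)"
      using xy u lagrangianD(1)[OF LL] by (intro pert(2)) (auto intro: subspace_diff)
    also have "\<psi> t (x - u) + y = - (\<psi> t u - \<psi> t0 u)"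
      using xy(1) u(2) by (simp add: blinfun.diff_right algebra_simps)
    also have "norm (- (\<psi> t u - \<psi> t0 u)) \<le> norm (\<psi> t - \<psi> t0) * norm u"
      using diff[of u] by (simp only: norm_minus_cancel)
    finally show ?thesis using ex by (simp add: wt)
  qed
  have ev: "\<forall>\<^sub>F t in at t0 within {0..T}. t \<in> {0..T} \<and> norm (\<psi> t - \<psi> t0) \<le> c / 2"
  proof -
    have "\<forall>\<^sub>F t in at t0 within {0..T}. norm (\<psi> t - \<psi> t0) < c / 2"
      by (rule order_tendstoD(2)[OF psi_tendsto[OF t0]]) (simp add: c(1))
    moreover have "\<forall>\<^sub>F t in at t0 within {0..T}. t \<in> {0..T}"
      by (simp add: eventually_at_filter)
    ultimately show ?thesis by eventually_elim auto
  qed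
  have w0: "w t0 = 0" using w[OF t0] c(1) by simp
  have wlim: "(w \<longlongrightarrow> 0) (at t0 within {0..T})"
  proof (rule Lim_null_comparison)
    show "\<forall>\<^sub>F t in at t0 within {0..T}. norm (w t) \<le> 2 * (norm (\<psi> t - \<psi> t0) * norm u)"
      using ev by eventually_elim (use w in auto)
    show "((\<lambda>t. 2 * (norm (\<psi> t - \<psi> t0) * norm u)) \<longlongrightarrow> 0) (at t0 within {0..T})"
      using tendsto_mult_right_zero[OF tendsto_mult_left_zero[OF psi_tendsto[OF t0]]] .
  qed
  let ?q = "\<lambda>t. (\<psi> t u - \<psi> t0 u) /\<^sub>R (t - t0)"
  have q: "(?q \<longlongrightarrow> J0 (B t0 v)) (at t0 within {0..T})"
    using has_vector_derivative_quotient[OF psi_ode[OF t0, of u]] by (simp add: u(2))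
  have "((\<lambda>t. omega0 v (?q t) + omega0 (w t) (?q t)) \<longlongrightarrow> omega0 v (J0 (B t0 v)) + omega0 0 (J0 (B t0 v)))
      (at t0 within {0..T})"
    by (intro tendsto_add bounded_bilinear.tendsto[OF bounded_bilinear_omega0] tendsto_const q wlim)
  moreover have "omega0 v (J0 (B t0 v)) + omega0 0 (J0 (B t0 v)) = v \<bullet> B t0 v"
    by (simp add: omega0_simps omega0_eq_inner_J0[of v] inner_J0_J0)
  ultimately have lim: "((\<lambda>t. omega0 v (?q t) + omega0 (w t) (?q t)) \<longlongrightarrow> v \<bullet> B t0 v) (at t0 within {0..T})"
    by simp
  have "\<forall>\<^sub>F t in at t0 within {0..T}. omega0 v (?q t) + omega0 (w t) (?q t) =
      (omega0 v (w t) - omega0 v (w t0)) / (t - t0)"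
    using ev
  proof eventually_elim
    case (elim t)
    have "omega0 (v + w t) (\<psi> t u) = 0"
      using w[of t] elim u(1) lagrangianD(3)[OF lagrangian_l[of t]] by blast
    then have "omega0 v (\<psi> t u - v) + omega0 (w t) (\<psi> t u - v) = omega0 v (w t)"
      using omega0_commute[of "w t" v] lagrangianD(3)[OF lag v v] by (simp add: omega0_simps)
    moreover have "omega0 x (?q t) = omega0 x (\<psi> t u - v) / (t - t0)" for x
      by (simp only: u(2) omega0_simps(6)) (simp add: divide_inverse)
    ultimately show ?case by (simp only: w0 omega0_simps(8) add_divide_distrib[symmetric] diff_zero)
  qed
  with lim have "((\<lambda>t. (omega0 v (w t) - omega0 v (w t0)) / (t - t0)) \<longlongrightarrow> v \<bullet> B t0 v) (at t0 within {0..T})"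
    by (rule Lim_transform_eventually)
  then show ?thesis by (simp add: has_field_derivative_iff w_def)
qed

text \<open>The plus condition is tested on the image of \<open>l t0\<close> under
  \<open>J0\<close>, a transversal Lagrangian for which \<open>crossing_derivative\<close> gives the
  crossing form in terms of \<open>B t0\<close>.\<close>

lemma plus_curve_positive:
  assumes plus: "plus_curve T l L0" and t0: "t0 \<in> {0..T}" and v: "v \<in> l t0 \<inter> L0" "v \<noteq> 0"
  shows "0 < v \<bullet> B t0 v"
proof -
  note lag = lagrangian_l[OF t0]
  have "lagrangian (J0 ` l t0)"
    by (rule lagrangian_image[OF linear_J0 _ lag]) (simp add: omega0_eq_inner_J0 inner_J0_J0)
  moreover have "J0 ` l t0 \<inter> l t0 = {0}"
  proof -
    have "y = 0" if Jy: "y \<in> J0 ` l t0" and y: "y \<in> l t0" for y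
    proof -
      obtain a where a: "y = J0 a" "a \<in> l t0" using Jy by blast
      have "y \<bullet> y = 0" using lagrangianD(3)[OF lag a(2) y] by (simp only: omega0_eq_inner_J0 a(1))
      then show ?thesis by simp
    qed
    then show ?thesis
      using lagrangianD(1)[OF \<open>lagrangian (J0 ` l t0)\<close>] lagrangianD(1)[OF lag] subspace_0 by blast
  qed
  moreover have "l t0 \<inter> L0 \<noteq> {0}" using v by auto
  ultimately obtain D where D: "D > 0"
    "((\<lambda>t. omega0 v (THE w. w \<in> J0 ` l t0 \<and> v + w \<in> l t)) has_real_derivative D) (at t0 within {0..T})"
    using plus t0 v unfolding plus_curve_def by blast
  \<comment> \<open>Since \<open>0 < T\<close>, one-sided derivatives at the endpoints are unique as
    well.\<close>
  have "at t0 within {0..T} \<noteq> bot" using t0 T by (simp add: trivial_limit_within)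
  then have "D = v \<bullet> B t0 v"
    using vector_derivative_unique_within D(2) crossing_derivative[OF t0, of v] v(1)
    by (auto simp: has_real_derivative_iff_has_vector_derivative)
  then show ?thesis using D(1) by simp
qed

section \<open>The Kashiwara form pulled back to a fixed space\<close>

definition lift_psi :: "real \<Rightarrow> ((real^'n) \<times> (real^'n)) \<times> ((real^'n) \<times> (real^'n)) \<times> ((real^'n) \<times> (real^'n)) \<Rightarrow>
    ((real^'n) \<times> (real^'n)) \<times> ((real^'n) \<times> (real^'n)) \<times> ((real^'n) \<times> (real^'n))" where
  "lift_psi t p = (\<psi> t (fst p), snd p)"

lemma linear_lift_psi: "linear (lift_psi t)"
  by (simp add: linear_iff lift_psi_def blinfun.add_right blinfun.scaleR_right)

lemma inj_lift_psi: "t \<in> {0..T} \<Longrightarrow> inj (lift_psi t)"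
  using inj_psi[of t] unfolding inj_def lift_psi_def prod_eq_iff fst_conv snd_conv by blast

lemma lift_psi_image: "lift_psi t ` (L \<times> M) = l t \<times> M"
  by (force simp: lift_psi_def image_iff)

text \<open>Trades the moving domain \<open>l t \<times> L1 \<times> L2\<close> for the fixed
  \<open>L \<times> L1 \<times> L2\<close>, where the perturbation lemmas apply.\<close>

definition pulled_form where
  "pulled_form t p q = kashiwara_form (lift_psi t p) (lift_psi t q)"

lemma sym_bilinear_pulled_form: "sym_bilinear (pulled_form t)"
proof -
  note k = sym_bilinear_kashiwara_form and lin = linear_lift_psi
  show ?thesis
    unfolding sym_bilinear_def bilinear_def linear_iff pulled_form_def
    by (auto simp only: linear_add[OF lin] linear_scale[OF lin] sym_bilinear_simps[OF k]
        sym_bilinear_commute[OF k] real_scaleR_def)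
qed

text \<open>Time derivative of \<open>pulled_form\<close>: only the four terms involving the first
  slot move, and the two pairing the second slot with the third are constant.\<close>

definition form_deriv where
  "form_deriv t p q =
    omega0 (fst (snd p)) (J0 (B t (\<psi> t (fst q)))) + omega0 (fst (snd q)) (J0 (B t (\<psi> t (fst p)))) +
    omega0 (J0 (B t (\<psi> t (fst p)))) (snd (snd q)) + omega0 (J0 (B t (\<psi> t (fst q)))) (snd (snd p))"

lemma sym_bilinear_form_deriv: "sym_bilinear (form_deriv t)"
  unfolding sym_bilinear_def bilinear_def linear_iff form_deriv_def
  by (simp add: blinfun.add_right blinfun.scaleR_right linear_add[OF linear_J0]
      linear_scale[OF linear_J0] omega0_simps algebra_simps)

lemma pulled_form_deriv:
  assumes t: "t \<in> {0..T}"
  shows "((\<lambda>t. pulled_form t p q) has_real_derivative form_deriv t p q) (at t within {0..T})"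
proof -
  note R = bounded_linear.has_vector_derivative[OF bounded_bilinear.bounded_linear_right[OF bounded_bilinear_omega0]]
  note L = bounded_linear.has_vector_derivative[OF bounded_bilinear.bounded_linear_left[OF bounded_bilinear_omega0]]
  have eq: "pulled_form t p q =
    (omega0 (fst (snd p)) (\<psi> t (fst q)) + omega0 (fst (snd q)) (\<psi> t (fst p)) +
    omega0 (\<psi> t (fst p)) (snd (snd q)) + omega0 (\<psi> t (fst q)) (snd (snd p))) +
    (omega0 (snd (snd p)) (fst (snd q)) + omega0 (snd (snd q)) (fst (snd p)))" for t
    by (simp add: pulled_form_def kashiwara_form_def lift_psi_def case_prod_unfold)
  have "((\<lambda>t. pulled_form t p q) has_vector_derivative form_deriv t p q + 0) (at t within {0..T})"
    unfolding eq form_deriv_def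
    by (intro has_vector_derivative_add R L psi_ode t has_vector_derivative_const)
  then show ?thesis by (simp add: has_real_derivative_iff_has_vector_derivative)
qed

end

section \<open>Index jumps at crossings\<close>

locale crossing_flow = hamiltonian_flow +
  fixes L1 L2 :: "((real^'a) \<times> (real^'a)) set"
  assumes LL1: "lagrangian L1" and LL2: "lagrangian L2"
    and plus1: "plus_curve T l L1" and plus2: "plus_curve T l L2"
begin

abbreviation E where "E \<equiv> L \<times> L1 \<times> L2"

abbreviation index where "index t \<equiv> kashiwara_index (l t) L1 L2"

lemma subspace_E: "subspace E"
  by (rule subspace_lagrangian_Times[OF LL LL1 LL2])

lemma pos_index_pulled_form: "t \<in> {0..T} \<Longrightarrow> pos_index E (pulled_form t) = index t"
  using pos_index_image[OF linear_lift_psi inj_lift_psi, of t E kashiwara_form]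
  by (simp add: lift_psi_image pulled_form_def[abs_def])

lemma radical_pulled_form:
  "lift_psi t ` form_radical E (pulled_form t) = form_radical (l t \<times> L1 \<times> L2) kashiwara_form"
  using form_radical_image[of "lift_psi t" E kashiwara_form]
  by (simp add: lift_psi_image pulled_form_def[abs_def])

lemma dim_lift_psi_image: "t \<in> {0..T} \<Longrightarrow> dim (lift_psi t ` S) = dim S"
  by (rule dim_image_eq[OF linear_lift_psi]) (auto intro: inj_on_subset[OF inj_lift_psi])

lemma dim_radical_pulled_form:
  assumes t: "t \<in> {0..T}"
  shows "dim (form_radical E (pulled_form t)) = dim (L1 \<inter> L2) + dim (l t \<inter> L1) + dim (l t \<inter> L2)"
  using dim_lift_psi_image[OF t, of "form_radical E (pulled_form t)"] radical_pulled_form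
    dim_kashiwara_radical[OF lagrangian_l[OF t] LL1 LL2] by simp

text \<open>The sign \<open>\<sigma>\<close> selects the direction of time:
  \<open>\<sigma> * (t - t0)\<close> serves as the positive step, and backward in time the
  first-order term changes sign. The part of the radical that persists has dimension
  \<open>dim (L1 \<inter> L2)\<close>.\<close>

lemma one_sided_jump:
  assumes t0: "t0 \<in> {0..T}" and \<sigma>: "\<sigma> = 1 \<or> \<sigma> = -1"
    and N1: "subspace N1" "N1 \<subseteq> form_radical E (pulled_form t0)" "posdef_on (\<lambda>p q. \<sigma> * form_deriv t0 p q) N1"
    and N2: "subspace N2" "N2 \<subseteq> form_radical E (pulled_form t0)" "posdef_on (\<lambda>p q. - (\<sigma> * form_deriv t0 p q)) N2"
    and d: "dim N1 + dim N2 = dim (l t0 \<inter> L1) + dim (l t0 \<inter> L2)"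
  shows "\<forall>\<^sub>F t in at t0 within {t\<in>{0..T}. 0 < \<sigma> * (t - t0)}.
    index t = index t0 + dim N1 \<and> dim (l t \<inter> L1) = 0 \<and> dim (l t \<inter> L2) = 0"
proof -
  let ?F = "at t0 within {t\<in>{0..T}. 0 < \<sigma> * (t - t0)}"
  have evT: "\<forall>\<^sub>F t in ?F. t \<in> {0..T}" "\<forall>\<^sub>F t in ?F. 0 < \<sigma> * (t - t0)"
    by (simp_all add: eventually_at_filter)
  have "\<forall>\<^sub>F t in ?F. pos_index E (pulled_form t) = pos_index E (pulled_form t0) + dim N1 \<and>
      dim (form_radical E (pulled_form t)) = dim (L1 \<inter> L2)"
  proof (rule eventually_pos_index_eq[where h = "\<lambda>t. \<sigma> * (t - t0)", OF _ _ _ _ evT(2) _ subspace_E N1 N2])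
    show "sym_bilinear (\<lambda>p q. \<sigma> * form_deriv t0 p q)"
      using sym_bilinear_divide[OF sym_bilinear_form_deriv, of t0 "1 / \<sigma>"] by (simp add: mult.commute)
    fix p q
    have "((\<lambda>t. (pulled_form t p q - pulled_form t0 p q) / (t - t0)) \<longlongrightarrow> form_deriv t0 p q) ?F"
      using pulled_form_deriv[OF t0, of p q] unfolding has_field_derivative_iff
      by (rule tendsto_within_subset) auto
    then have lim: "((\<lambda>t. \<sigma> * ((pulled_form t p q - pulled_form t0 p q) / (t - t0))) \<longlongrightarrow> \<sigma> * form_deriv t0 p q) ?F"
      by (intro tendsto_mult tendsto_const)
    show "((\<lambda>t. (pulled_form t p q - pulled_form t0 p q) / (\<sigma> * (t - t0))) \<longlongrightarrow> \<sigma> * form_deriv t0 p q) ?F"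
    proof -
      have "\<sigma> * (y / d) = y / (\<sigma> * d)" for y d :: real using \<sigma> by auto
      from this[symmetric] show ?thesis using lim by (simp only:)
    qed
  next
    have "((\<lambda>t. \<sigma> * (t - t0)) \<longlongrightarrow> \<sigma> * (t0 - t0)) ?F"
      by (intro tendsto_intros)
    then show "((\<lambda>t. \<sigma> * (t - t0)) \<longlongrightarrow> 0) ?F" by simp
    show "dim (form_radical E (pulled_form t0)) = dim (L1 \<inter> L2) + dim N1 + dim N2"
      using d dim_radical_pulled_form[OF t0] by simp
    show "\<forall>\<^sub>F t in ?F. dim (L1 \<inter> L2) \<le> dim (form_radical E (pulled_form t))"
      using evT(1) by eventually_elim (simp add: dim_radical_pulled_form)
  qed (rule sym_bilinear_pulled_form)+
  then show ?thesis using evT(1)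
    by eventually_elim (use t0 in \<open>auto simp: pos_index_pulled_form dim_radical_pulled_form\<close>)
qed

text \<open>On the copies of \<open>l t0 \<inter> L1\<close> and \<open>l t0 \<inter> L2\<close> in
  the radical, \<open>form_deriv\<close> takes the values \<open>2 * (a \<bullet> B t0 a)\<close>
  and \<open>- 2 * (a \<bullet> B t0 a)\<close>, so the plus conditions make it definite with
  opposite signs.\<close>

lemma index_jump:
  assumes t0: "t0 \<in> {0..T}"
  shows "\<forall>\<^sub>F t in at t0 within {0..T}. (dim (l t \<inter> L1) = 0 \<and> dim (l t \<inter> L2) = 0) \<and>
    (t0 < t \<longrightarrow> index t = index t0 + dim (l t0 \<inter> L1)) \<and>
    (t < t0 \<longrightarrow> index t = index t0 + dim (l t0 \<inter> L2))"
proof -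
  note lag = lagrangian_l[OF t0]
  have sub: "subspace (l t0 \<inter> L1)" "subspace (l t0 \<inter> L2)"
    using lagrangianD(1)[OF lag] lagrangianD(1)[OF LL1] lagrangianD(1)[OF LL2] by (auto intro: subspace_inter)
  let ?D1 = "(\<lambda>a. (a, a, 0)) ` (l t0 \<inter> L1)" and ?D2 = "(\<lambda>a. (a, 0, a)) ` (l t0 \<inter> L2)"
  define N1 where "N1 = lift_psi t0 -` ?D1"
  define N2 where "N2 = lift_psi t0 -` ?D2"
  note D1 = diagonal_in_radical(1)[OF lag LL1 LL2] and D2 = diagonal_in_radical(2)[OF lag LL1 LL2]
  have s: "subspace N1" "subspace N2"
    unfolding N1_def N2_def
    by (rule linear_subspace_vimage[OF linear_lift_psi diagonal_subspaces(1)[OF sub(1)]]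
        linear_subspace_vimage[OF linear_lift_psi diagonal_subspaces(3)[OF sub(2)]])+
  \<comment> \<open>Ensures that the preimages \<open>N1\<close> and \<open>N2\<close> map onto the
    whole diagonal copies.\<close>
  have rng: "form_radical (l t0 \<times> L1 \<times> L2) kashiwara_form \<subseteq> range (lift_psi t0)"
    unfolding radical_pulled_form[symmetric] by (rule image_mono) simp
  have im: "lift_psi t0 ` N1 = ?D1" "lift_psi t0 ` N2 = ?D2"
    unfolding N1_def N2_def image_vimage_eq
    by (rule Int_absorb2[OF order_trans[OF D1 rng]] Int_absorb2[OF order_trans[OF D2 rng]])+
  have r: "N1 \<subseteq> form_radical E (pulled_form t0)" "N2 \<subseteq> form_radical E (pulled_form t0)"
    using D1 D2 unfolding im[symmetric] radical_pulled_form[symmetric]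
      inj_image_subset_iff[OF inj_lift_psi[OF t0]] .
  have dm: "dim N1 = dim (l t0 \<inter> L1)" "dim N2 = dim (l t0 \<inter> L2)"
    using dim_lift_psi_image[OF t0, of N1] dim_lift_psi_image[OF t0, of N2] im
      diagonal_subspaces(2)[OF sub(1)] diagonal_subspaces(4)[OF sub(2)] by simp_all
  have nz: "lift_psi t0 p \<noteq> 0" if "p \<noteq> 0" for p
    using that linear_injective_0[OF linear_lift_psi] inj_lift_psi[OF t0] by blast
  have pos: "0 < form_deriv t0 p p" if p: "p \<in> N1" "p \<noteq> 0" for p
  proof -
    obtain a where a: "a \<in> l t0 \<inter> L1" "lift_psi t0 p = (a, a, 0)" using p(1) unfolding N1_def by blast
    then have "a \<noteq> 0" using nz[OF p(2)] by (auto simp: zero_prod_def)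
    then have "0 < a \<bullet> B t0 a" by (rule plus_curve_positive[OF plus1 t0 a(1)])
    moreover have "\<psi> t0 (fst p) = a" "fst (snd p) = a" "snd (snd p) = 0"
      using a(2) by (auto simp: lift_psi_def prod_eq_iff)
    ultimately show ?thesis
      by (simp add: form_deriv_def omega0_simps omega0_eq_inner_J0 inner_J0_J0)
  qed
  have neg: "form_deriv t0 p p < 0" if p: "p \<in> N2" "p \<noteq> 0" for p
  proof -
    obtain a where a: "a \<in> l t0 \<inter> L2" "lift_psi t0 p = (a, 0, a)" using p(1) unfolding N2_def by blast
    then have "a \<noteq> 0" using nz[OF p(2)] by (auto simp: zero_prod_def)
    then have "0 < a \<bullet> B t0 a" by (rule plus_curve_positive[OF plus2 t0 a(1)])
    moreover have "\<psi> t0 (fst p) = a" "fst (snd p) = 0" "snd (snd p) = a"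
      using a(2) by (auto simp: lift_psi_def prod_eq_iff)
    ultimately show ?thesis
      by (simp add: form_deriv_def omega0_simps omega0_eq_inner_J0 J0_J0 linear_0[OF linear_J0] inner_commute)
  qed
  have P: "posdef_on (form_deriv t0) N1" "posdef_on (\<lambda>p q. - form_deriv t0 p q) N2"
    unfolding posdef_on_def neg_0_less_iff_less using pos neg by blast+
  have "\<forall>\<^sub>F t in at t0 within {t\<in>{0..T}. 0 < 1 * (t - t0)}.
      index t = index t0 + dim N1 \<and> dim (l t \<inter> L1) = 0 \<and> dim (l t \<inter> L2) = 0"
    by (rule one_sided_jump[OF t0 _ s(1) r(1) _ s(2) r(2)]) (simp_all add: P dm)
  \<comment> \<open>To the left of \<open>t0\<close> the roles of \<open>N1\<close> and
    \<open>N2\<close> are exchanged.\<close>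
  moreover have "\<forall>\<^sub>F t in at t0 within {t\<in>{0..T}. 0 < - 1 * (t - t0)}.
      index t = index t0 + dim N2 \<and> dim (l t \<inter> L1) = 0 \<and> dim (l t \<inter> L2) = 0"
    by (rule one_sided_jump[OF t0 _ s(2) r(2) _ s(1) r(1)]) (simp_all add: P dm)
  ultimately show ?thesis
    unfolding eventually_at_filter dm by eventually_elim auto
qed

lemma nu_index_eq:
  assumes "lagrangian L0"
  shows "nu_index T l L0 = (\<Sum>t\<in>{t\<in>{0..T}. dim (l t \<inter> L0) \<noteq> 0}. dim (l t \<inter> L0))"
proof -
  have "l t \<inter> L0 \<noteq> {0} \<longleftrightarrow> dim (l t \<inter> L0) \<noteq> 0" if t: "t \<in> {0..T}" for t
  proof -
    have "0 \<in> l t \<inter> L0"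
      using subspace_0[OF lagrangianD(1)[OF lagrangian_l[OF t]]] subspace_0[OF lagrangianD(1)[OF assms]]
      by (rule IntI)
    then show ?thesis unfolding dim_eq_0 by blast
  qed
  then have "{t\<in>{0..T}. l t \<inter> L0 \<noteq> {0}} = {t\<in>{0..T}. dim (l t \<inter> L0) \<noteq> 0}" by blast
  then show ?thesis by (simp only: nu_index_def)
qed

text \<open>The two terms on the right are the values the index would have just after
  \<open>T\<close> and just before \<open>0\<close>; in this way crossings at the endpoints are
  counted in full.\<close>

lemma nu_index_diff:
  "int (nu_index T l L1) - int (nu_index T l L2) =
    int (index T + dim (l T \<inter> L1)) - int (index 0 + dim (l 0 \<inter> L2))"
  unfolding nu_index_eq[OF LL1] nu_index_eq[OF LL2]
proof (rule jump_sum[where ?d1.0 = "\<lambda>t. dim (l t \<inter> L1)" and ?d2.0 = "\<lambda>t. dim (l t \<inter> L2)"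
      and f = index, OF T])
  fix s assume s: "s \<in> {0..T}"
  show "\<forall>\<^sub>F t in at s within {0..T}. dim (l t \<inter> L1) = 0 \<and> dim (l t \<inter> L2) = 0"
    using index_jump[OF s] by eventually_elim blast
  show "\<forall>\<^sub>F t in at s within {0..T}. (s < t \<longrightarrow> index t = index s + dim (l s \<inter> L1)) \<and>
      (t < s \<longrightarrow> index t = index s + dim (l s \<inter> L2))"
    using index_jump[OF s] by eventually_elim blast
qed

end

theorem theorem3p12:
  fixes T :: real
    and B \<psi> :: "real \<Rightarrow> ((real^'n) \<times> (real^'n)) \<Rightarrow>\<^sub>L ((real^'n) \<times> (real^'n))"
    and L L1 L2 :: "((real^'n) \<times> (real^'n)) set"
  assumes T: "0 < T"
    and B_cont: "continuous_on {0..T} B"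
    and B_sym: "\<And>t. t \<in> {0..T} \<Longrightarrow> symmetric_op (B t)"
    and psi0: "\<psi> 0 = id_blinfun"
    and psi_ode: "\<And>t z. t \<in> {0..T} \<Longrightarrow>
       ((\<lambda>s. blinfun_apply (\<psi> s) z) has_vector_derivative
          J0 (blinfun_apply (B t) (blinfun_apply (\<psi> t) z))) (at t within {0..T})"
    and LL: "lagrangian L" and LL1: "lagrangian L1" and LL2: "lagrangian L2"
    and plus1: "plus_curve T (\<lambda>t. blinfun_apply (\<psi> t) ` L) L1"
    and plus2: "plus_curve T (\<lambda>t. blinfun_apply (\<psi> t) ` L) L2"
  shows
    "let l = (\<lambda>t. blinfun_apply (\<psi> t) ` L);
         e1 = dim (L \<inter> l T) - dim (L \<inter> l T \<inter> L1);
         e2 = dim (L \<inter> l T) - dim (L \<inter> l T \<inter> L2);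
         \<delta>1 = set_plus (L \<inter> L1) (L1 \<inter> L2);
         \<delta>2 = set_plus (l T \<inter> L2) (L1 \<inter> L2);
         k1 = min e1 e2;
         k2 = min (dim \<delta>1) (dim \<delta>2);
         k = max k1 k2
     in \<bar>int (nu_index T l L2) - int (nu_index T l L1)\<bar> \<le> int CARD('n) - int k"
proof -
  interpret hamiltonian_flow T B \<psi> L
    by unfold_locales (fact T B_sym psi0 psi_ode LL)+
  interpret crossing_flow T B \<psi> L L1 L2
    by unfold_locales (fact LL1 LL2 plus1 plus2)+
  have l0: "l 0 = L" by (simp add: psi0)
  have lT: "lagrangian (l T)" using T by (intro lagrangian_l) simp
  have sw: "l T \<inter> L = L \<inter> l T" by auto
  \<comment> \<open>Rules out truncation in the natural-number subtractions of \<open>e1\<close> and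
    \<open>e2\<close>.\<close>
  have "dim (L \<inter> l T \<inter> L1) \<le> dim (L \<inter> l T)" "dim (L \<inter> l T \<inter> L2) \<le> dim (L \<inter> l T)"
    by (auto intro: dim_subset)
  \<comment> \<open>For \<open>k2\<close>, each of \<open>index T + dim (l T \<inter> L1)\<close>
    and \<open>index 0 + dim (L \<inter> L2)\<close> is at least \<open>n\<close>, and they are at
    most \<open>2 n - dim \<delta>2\<close> and \<open>2 n - dim \<delta>1\<close>. For
    \<open>k1\<close>, the comparison from \<open>l T\<close> to \<open>L\<close> bounds the
    difference of the two by \<open>n - e1\<close>, and the one from \<open>L\<close> to
    \<open>l T\<close> bounds its negative by \<open>n - e2\<close>.\<close>
  then show ?thesis
    using nu_index_diff[unfolded l0]
      kashiwara_index_bounds[OF LL LL1 LL2] kashiwara_index_bounds[OF lT LL1 LL2]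
      kashiwara_index_compare_common(1)[OF lT LL LL1 LL2, unfolded sw]
      kashiwara_index_compare_common(2)[OF LL lT LL1 LL2]
    unfolding Let_def by linarith
qed

end
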